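(* Let $Q\subset\mathbb{R}^2$ be a lattice polygon, and let $P\subset\mathbb{R}^2$ be a lattice polytope that is a weak Minkowski summand of $Q$. Then the Cayley sum $\mathrm{Cay}(P,Q)\subset\mathbb{R}^3$ has a unimodular cover.
   Context: Lattices are $\mathbb{Z}^2\subset\mathbb{R}^2$ and $\mathbb{Z}^3\subset\mathbb{R}^3$. A lattice polytope is the convex hull of finitely many lattice points; a lattice polygon is a $2$-dimensional lattice polytope. $P$ is not required to be full-dimensional. A polytope $P$ is a weak Minkowski summand of a polytope $Q$ if the normal fan of $Q$ refines that of $P$; equivalently, if there exist a polytope $P'$ and a constant $k>0$ such that $P+P'=kQ$ (Minkowski sum). The Cayley sum of lattice polytopes $P,Q\subset\mathbb{R}^2$ is $\mathrm{Cay}(P,Q):=\mathrm{conv}(P\times\{0\}\cup Q\times\{1\})\subset\mathbb{R}^{3}$. A unimodular tetrahedron is a lattice tetrahedron whose edge vectors from one vertex form a basis of $\mathbb{Z}^3$ (normalized volume $1$). A unimodular cover of a $3$-dimensional lattice polytope is a collection of unimodular tetrahedra whose union equals the polytope. *)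

theory Defs
  imports "HOL-Analysis.Analysis"
begin

definition int_lattice :: "(real ^ 'n) set" where
  "int_lattice = {x. \<forall>i. x $ i \<in> \<int>}"

definition lattice_polytope :: "(real ^ 'n) set \<Rightarrow> bool" where
  "lattice_polytope P \<longleftrightarrow> (\<exists>S. finite S \<and> S \<subseteq> int_lattice \<and> P = convex hull S)"

definition lattice_polygon :: "(real ^ 'n) set \<Rightarrow> bool" where
  "lattice_polygon P \<longleftrightarrow> lattice_polytope P \<and> aff_dim P = 2"

(* Outer normals are used; with inner normals every cone is replaced by its negative, which does
   not affect refinement. *)
definition normal_cone :: "'a::euclidean_space set \<Rightarrow> 'a set \<Rightarrow> 'a set" where
  "normal_cone P F = {u. \<forall>x\<in>F. \<forall>y\<in>P. u \<bullet> y \<le> u \<bullet> x}"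

definition normal_fan :: "'a::euclidean_space set \<Rightarrow> 'a set set" where
  "normal_fan P = {normal_cone P F |F. F face_of P \<and> F \<noteq> {}}"

definition fan_refines :: "'a set set \<Rightarrow> 'a set set \<Rightarrow> bool" where
  "fan_refines \<F> \<G> \<longleftrightarrow> \<Union>\<F> = \<Union>\<G> \<and> (\<forall>C\<in>\<F>. \<exists>D\<in>\<G>. C \<subseteq> D)"

(* The normal fan of a nonempty polytope covers the whole space, whereas that of the empty set has
   no cones. So the empty set is not a weak Minkowski summand of a nonempty polytope. *)
definition weak_Minkowski_summand :: "'a::euclidean_space set \<Rightarrow> 'a set \<Rightarrow> bool" where
  "weak_Minkowski_summand P Q \<longleftrightarrow> fan_refines (normal_fan Q) (normal_fan P)"

definition at_height :: "real \<Rightarrow> real ^ 2 \<Rightarrow> real ^ 3" where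
  "at_height h x = vector [x $ 1, x $ 2, h]"

definition Cayley_sum :: "(real ^ 2) set \<Rightarrow> (real ^ 2) set \<Rightarrow> (real ^ 3) set" where
  "Cayley_sum P Q = convex hull (at_height 0 ` P \<union> at_height 1 ` Q)"

definition lattice_basis :: "('n \<Rightarrow> real ^ 'n) \<Rightarrow> bool" where
  "lattice_basis b \<longleftrightarrow>
     range b \<subseteq> int_lattice \<and>
     (\<forall>z\<in>int_lattice. \<exists>!c :: 'n \<Rightarrow> int. z = (\<Sum>i\<in>UNIV. of_int (c i) *\<^sub>R b i))"

(* b lists the edge vectors at the vertex v. A basis of the integer lattice is linearly independent
   over the reals, so T is a nondegenerate tetrahedron. *)
definition unimodular_tetrahedron :: "(real ^ 3) set \<Rightarrow> bool" where
  "unimodular_tetrahedron T \<longleftrightarrow>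
     (\<exists>v b. v \<in> int_lattice \<and> lattice_basis b \<and>
        T = convex hull (insert v (range (\<lambda>i. v + b i))))"

definition unimodular_cover :: "(real ^ 3) set set \<Rightarrow> (real ^ 3) set \<Rightarrow> bool" where
  "unimodular_cover \<T> R \<longleftrightarrow> (\<forall>T\<in>\<T>. unimodular_tetrahedron T) \<and> \<Union>\<T> = R"

end

theory Submission
  imports Defs
begin

text \<open>
  A cover need not be finite, so it suffices to put each point of the Cayley sum into a unimodular
  tetrahedron inside the Cayley sum. By Caratheodory's theorem the point lies in a nondegenerate
  tetrahedron whose vertices are lattice points of \<open>P\<close> at height 0 and of \<open>Q\<close> at height 1, and this
  tetrahedron is then replaced by others, finally by a unimodular one that still contains the point. The
  replacement step is \<open>tetrahedron_exchange\<close>: if \<open>w\<close> is an affine combination of the four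
  vertices, then the given tetrahedron is covered by those that arise by putting \<open>w\<close> in the place of
  a vertex with positive coefficient; the volume is multiplied by that coefficient.

  A tetrahedron with three vertices at one height is handled by a lattice point, not a vertex, of its
  horizontal triangle (\<open>covered_apex_triangle\<close>). The remaining tetrahedra have an edge
  \<open>[p, p + u]\<close> in \<open>P\<close> and an edge \<open>[q, q + v]\<close> in \<open>Q\<close>, and are unimodular if
  \<open>det(u, v) = \<plusminus>1\<close>. Otherwise the exchange step works with a lattice point of \<open>Q\<close> strictly
  inside the strip between the lines through \<open>q\<close> and \<open>q + v\<close> parallel to \<open>u\<close>, or a lattice point of \<open>P\<close>
  strictly inside the strip between the lines through \<open>p\<close> and \<open>p + u\<close> parallel to \<open>v\<close>
  (\<open>covered_opposite_edges\<close>): it yields tetrahedra of the same kind with smaller volume and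
  tetrahedra with a horizontal triangle.

  The heart of the proof is that one of the two strips contains such a point
  (\<open>lattice_point_in_strip\<close>). Suppose not. In coordinates \<open>(x, y)\<close> with respect to \<open>u\<close> and \<open>v\<close>,
  with \<open>p\<close> respectively \<open>q\<close> as the origin, let the chords of \<open>Q\<close> at \<open>y = 0\<close> and \<open>y = 1\<close> be
  \<open>[l0, r0]\<close> and \<open>[l1, r1]\<close>. By symmetry the upper chord is not longer than the lower one, and
  the edge of \<open>P\<close> that bounds \<open>P\<close> from above in the strip \<open>0 < x < 1\<close> has slope \<open>t \<ge> 0\<close>; as
  \<open>P\<close> has no lattice point in its strip, \<open>t < 1\<close>. A pigeonhole argument in that strip gives
  \<open>X (1 - t) \<ge> 1\<close> for each lattice vector \<open>(X, t X)\<close> with \<open>X > 0\<close>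
  (\<open>lattice_slope_bound\<close>). Since the normal fan of \<open>Q\<close> refines that of \<open>P\<close>, also \<open>Q\<close> has an edge
  with the same outer normal (\<open>parallel_edge_of_refining_fan\<close>); let \<open>A\<close> and \<open>B\<close> be two of its lattice
  points, \<open>B\<close> to the right of \<open>A\<close>. Both lie at height at least 1, and there convexity of \<open>Q\<close> forces
  \<open>x(B) - x(A) \<le> (r1 - l1) + (r1 - r0) (y(B) - y(A)) < 1 + (y(B) - y(A))\<close>; here \<open>r1 - l1 < 1\<close> and
  \<open>r1 - r0 \<le> 1\<close> because \<open>Q\<close> has no lattice point in its strip. This contradicts the bound for the lattice vector \<open>B - A\<close>.
\<close>

section \<open>Planar lattices in coordinates\<close>

lemma convex_segment_pair:
  fixes S :: "(real \<times> real) set"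
  assumes "convex S" "(x1, y1) \<in> S" "(x2, y2) \<in> S" "0 \<le> t" "t \<le> 1"
    and "x = x1 + t * (x2 - x1)" "y = y1 + t * (y2 - y1)"
  shows "(x, y) \<in> S"
proof -
  have "(1 - t) *\<^sub>R (x1, y1) + t *\<^sub>R (x2, y2) \<in> S"
    using assms by (intro convexD) auto
  then show ?thesis unfolding assms(6,7) by (simp add: algebra_simps)
qed

lemma convex_triangle_pair:
  fixes S :: "(real \<times> real) set"
  assumes "convex S" "(x1, y1) \<in> S" "(x2, y2) \<in> S" "(x3, y3) \<in> S"
    and "0 \<le> a" "0 \<le> b" "0 \<le> c" "a + b + c = 1"
    and "x = a * x1 + b * x2 + c * x3" "y = a * y1 + b * y2 + c * y3"
  shows "(x, y) \<in> S"
proof -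
  have "convex hull {(x1, y1), (x2, y2), (x3, y3)} \<subseteq> S"
    using assms(1-4) by (intro hull_minimal) auto
  moreover have "a *\<^sub>R (x1, y1) + b *\<^sub>R (x2, y2) + c *\<^sub>R (x3, y3)
      \<in> convex hull {(x1, y1), (x2, y2), (x3, y3)}"
    unfolding convex_hull_3 using assms(5-8) by blast
  ultimately show ?thesis using assms(9,10) by auto
qed

text \<open>The integer lattice of the plane, written in coordinates with respect to two primitive lattice
  vectors with determinant \<open>\<plusminus>D\<close>, \<open>D \<ge> 2\<close>: an additive group containing \<open>(1, 0)\<close> and \<open>(0, 1)\<close> in
  which \<open>D\<close> times each determinant is an integer. Primitivity enters only through the last two
  conditions, which say that the lines \<open>y = 1/D\<close> and \<open>x = 1/D\<close> contain lattice points.\<close>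

definition coord_lattice :: "(real \<times> real) set \<Rightarrow> nat \<Rightarrow> bool" where
  "coord_lattice L D \<longleftrightarrow>
     2 \<le> D \<and> (1, 0) \<in> L \<and> (0, 1) \<in> L \<and> (\<forall>r\<in>L. \<forall>s\<in>L. r - s \<in> L) \<and>
     (\<forall>r\<in>L. \<forall>s\<in>L. real D * (fst r * snd s - snd r * fst s) \<in> \<int>) \<and>
     (\<exists>x. (x, 1 / D) \<in> L) \<and> (\<exists>y. (1 / D, y) \<in> L)"

lemma coord_lattice_diff: "coord_lattice L D \<Longrightarrow> r \<in> L \<Longrightarrow> s \<in> L \<Longrightarrow> r - s \<in> L"
  by (simp add: coord_lattice_def)

lemma coord_lattice_zero: "coord_lattice L D \<Longrightarrow> (0, 0) \<in> L"
  using coord_lattice_diff[of L D "(1,0)" "(1,0)"] by (simp add: coord_lattice_def zero_prod_def)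

lemma coord_lattice_uminus: "coord_lattice L D \<Longrightarrow> r \<in> L \<Longrightarrow> - r \<in> L"
  using coord_lattice_diff[of L D "(0,0)" r] coord_lattice_zero[of L D]
  by (simp add: zero_prod_def[symmetric])

lemma coord_lattice_add: "coord_lattice L D \<Longrightarrow> r \<in> L \<Longrightarrow> s \<in> L \<Longrightarrow> r + s \<in> L"
  using coord_lattice_diff[of L D r "- s"] coord_lattice_uminus[of L D s] by simp

lemma coord_lattice_nat_mult: "coord_lattice L D \<Longrightarrow> r \<in> L \<Longrightarrow> real n *\<^sub>R r \<in> L"
proof (induction n)
  case 0
  then show ?case using coord_lattice_zero[of L D] by (simp add: zero_prod_def)
next
  case (Suc n)
  then show ?case
    using coord_lattice_add[of L D r "real n *\<^sub>R r"] by (simp add: scaleR_left_distrib)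
qed

lemma coord_lattice_int_mult:
  assumes "coord_lattice L D" "r \<in> L"
  shows "of_int k *\<^sub>R r \<in> L"
proof (cases "0 \<le> k")
  case True
  then have "of_int k = real (nat k)" by simp
  then show ?thesis using coord_lattice_nat_mult[OF assms, of "nat k"] by metis
next
  case False
  then have "of_int k = - real (nat (- k))" by simp
  then show ?thesis
    using coord_lattice_uminus[OF assms(1) coord_lattice_nat_mult[OF assms, of "nat (- k)"]]
    by (metis scaleR_minus_left)
qed

lemma coord_lattice_swap:
  assumes "coord_lattice L D"
  shows "coord_lattice {(x, y). (y, x) \<in> L} D"
proof -
  have "real D * (fst r * snd s - snd r * fst s) \<in> \<int>"
    if "(snd r, fst r) \<in> L" "(snd s, fst s) \<in> L" for r s
  proof -
    have "real D * (snd r * fst s - fst r * snd s) \<in> \<int>"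
      using assms that unfolding coord_lattice_def by fastforce
    then have "- (real D * (snd r * fst s - fst r * snd s)) \<in> \<int>" by (rule Ints_minus)
    then show ?thesis by (simp add: algebra_simps)
  qed
  moreover have "r - s \<in> {(x, y). (y, x) \<in> L}"
    if "r \<in> {(x, y). (y, x) \<in> L}" "s \<in> {(x, y). (y, x) \<in> L}" for r s
    using coord_lattice_diff[OF assms, of "(snd r, fst r)" "(snd s, fst s)"] that
    by (simp add: case_prod_beta)
  ultimately show ?thesis
    using assms unfolding coord_lattice_def by (auto simp only: case_prod_beta mem_Collect_eq fst_conv snd_conv)
qed

lemma coord_lattice_column_point:
  assumes "coord_lattice L D"
  obtains y where "(real h / D, y) \<in> L" "c \<le> y" "y < c + 1"
proof -
  obtain y0 where "(1 / D, y0) \<in> L" using assms by (auto simp: coord_lattice_def)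
  from coord_lattice_nat_mult[OF assms this, of h]
  have 1: "(real h / D, real h * y0) \<in> L" by simp
  have 2: "(0, of_int \<lceil>c - h * y0\<rceil>) \<in> L"
    using coord_lattice_int_mult[OF assms, of "(0,1)"] assms by (auto simp: coord_lattice_def)
  have "(real h / D, real h * y0 + of_int \<lceil>c - h * y0\<rceil>) \<in> L"
    using coord_lattice_add[OF assms 1 2] by simp
  moreover have "c \<le> real h * y0 + of_int \<lceil>c - h * y0\<rceil>"
    "real h * y0 + of_int \<lceil>c - h * y0\<rceil> < c + 1" by linarith+
  ultimately show thesis using that by blast
qed

lemma coord_lattice_row_point:
  assumes "coord_lattice L D"
  obtains x where "(x, real h / D) \<in> L" "c \<le> x" "x < c + 1"
  using coord_lattice_column_point[OF coord_lattice_swap[OF assms], of h c] by auto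

section \<open>Lattice-free strips\<close>

text \<open>The triangle with vertices \<open>(0, 0)\<close>, \<open>(0, 1)\<close>, \<open>(1, 1)\<close> and its mirror image in the centre
  \<open>(1/2, 1/2)\<close> make up a unit square. A lattice point with ordinate \<open>1/D\<close> in the square lies in one of
  the two triangles, and the central symmetry moves it into the first one.\<close>

lemma lattice_point_in_triangle:
  assumes L: "coord_lattice L D" and "convex S" "(0, 0) \<in> S" "(0, 1) \<in> S" "(1, 1) \<in> S"
  obtains w where "w \<in> L \<inter> S" "0 < snd w" "snd w < 1"
proof -
  have D: "2 \<le> D" using L by (simp add: coord_lattice_def)
  have S: "(x, y) \<in> S" if "0 \<le> x" "x \<le> y" "y \<le> 1" for x y
    by (rule convex_triangle_pair[of S 0 0 0 1 1 1 "1 - y" "y - x" x])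
      (use that assms(2-) in \<open>auto\<close>)
  obtain x where x: "(x, 1 / D) \<in> L" "0 \<le> x" "x < 1"
    using coord_lattice_row_point[OF L, of 1 0] by auto
  show thesis
  proof (cases "x \<le> 1 / D")
    case True
    then show thesis using x D S[of x "1 / D"] that[of "(x, 1 / D)"] by auto
  next
    case False
    have "(1, 1) \<in> L" using coord_lattice_add[OF L, of "(1,0)" "(0,1)"] L by (auto simp: coord_lattice_def)
    then have "(1 - x, 1 - 1 / D) \<in> L" using coord_lattice_diff[OF L _ x(1), of "(1,1)"] by simp
    moreover have "1 - x \<le> 1 - 1 / D" using False by simp
    ultimately show thesis using x D S[of "1 - x" "1 - 1 / D"] that[of "(1 - x, 1 - 1 / D)"] by auto
  qed
qed

text \<open>The triangle with vertices \<open>(0, 0)\<close>, \<open>(1, 0)\<close>, \<open>(1, t)\<close> and its mirror image in \<open>(1/2, 0)\<close> contain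
  no lattice points with \<open>0 < x < 1\<close>. So on each line \<open>x = h/D\<close> with \<open>0 < h < D\<close> some lattice point
  lies strictly between the lines of slope \<open>t\<close> through \<open>(0, 0)\<close> and \<open>(1, 1)\<close>. The determinants of these
  \<open>D - 1\<close> points with \<open>(X, t X)\<close>, multiplied by \<open>D\<close>, are distinct integers strictly between 0 and
  \<open>D X (1 - t)\<close>.\<close>

lemma lattice_slope_bound:
  assumes L: "coord_lattice L D" and "convex S" "(0, 0) \<in> S" "(1, 0) \<in> S" "(1, t) \<in> S"
    and t: "0 \<le> t" "t < 1"
    and free: "\<And>w. w \<in> L \<inter> S \<Longrightarrow> \<not> (0 < fst w \<and> fst w < 1)"
    and dir: "\<And>w. w \<in> L \<Longrightarrow> snd w = t * fst w \<Longrightarrow> \<not> (0 < fst w \<and> fst w < 1)"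
    and W: "(X, t * X) \<in> L" "0 < X"
  shows "1 \<le> X * (1 - t)"
proof -
  have D: "2 \<le> D" using L by (simp add: coord_lattice_def)
  have S: "(x, y) \<in> S" if "0 \<le> y" "y \<le> t * x" "0 \<le> x" "x \<le> 1" for x y
  proof (cases "t = 0")
    case True
    then have y0: "y = 0" using that by auto
    show ?thesis
      by (rule convex_segment_pair[of S 0 0 1 0 x])
        (use y0 that assms(2-5) in \<open>auto\<close>)
  next
    case False
    have "0 < t" using False t by simp
    then have yt: "y / t \<le> x" using that by (simp add: divide_le_eq mult.commute)
    show ?thesis
      by (rule convex_triangle_pair[of S 0 0 1 0 1 t "1 - x" "x - y / t" "y / t"])
        (use yt that assms(2-5) False t in \<open>auto\<close>)
  qed
  have ex: "\<exists>y. (real h / D, y) \<in> L \<and> t * (h / D) < y \<and> y < t * (h / D) + 1 - t" if h: "h \<in> {0<..<D}" for h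
  proof -
    define x where "x = real h / D"
    have x: "0 < x" "x < 1" using h by (auto simp: x_def)
    obtain y where y: "(x, y) \<in> L" "t * x - t \<le> y" "y < t * x - t + 1"
      using coord_lattice_column_point[OF L, of h "t * x - t"] unfolding x_def by auto
    have "t * x < y"
    proof (rule ccontr)
      assume "\<not> t * x < y"
      consider "0 \<le> y" | "y < 0" by linarith
      then show False
      proof cases
        case 1
        then show False using S[of y x] free[of "(x, y)"] x y \<open>\<not> t * x < y\<close> by auto
      next
        case 2
        \<comment> \<open>The mirror image in \<open>(1/2, 0)\<close> lies in the triangle.\<close>
        have "(1 - x, - y) \<in> L" using coord_lattice_diff[OF L _ y(1), of "(1,0)"] L by (auto simp: coord_lattice_def)
        moreover have "- y \<le> t * (1 - x)" using y by (simp add: algebra_simps)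
        ultimately show False using S[of "-y" "1-x"] free[of "(1 - x, - y)"] x 2 by auto
      qed
    qed
    then show ?thesis using y unfolding x_def by auto
  qed
  then obtain y where y: "\<And>h. h \<in> {0<..<D} \<Longrightarrow>
      (real h / D, y h) \<in> L \<and> t * (h / D) < y h \<and> y h < t * (h / D) + 1 - t"
    by metis
  define G where "G h = real D * (X * y h - t * X * (h / D))" for h
  define g where "g h = \<lfloor>G h\<rfloor>" for h
  have gG: "of_int (g h) = G h" if "h \<in> {0<..<D}" for h
  proof -
    have "real D * (fst (X, t * X) * snd (real h / D, y h) - snd (X, t * X) * fst (real h / D, y h)) \<in> \<int>"
      using L W(1) y[OF that] unfolding coord_lattice_def by blast
    then have "G h \<in> \<int>" by (simp add: G_def)
    then show ?thesis unfolding g_def by (simp add: of_int_floor)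
  qed
  have "(1, 1) \<in> L" using coord_lattice_add[OF L, of "(1,0)" "(0,1)"] L by (auto simp: coord_lattice_def)
  then have "real D * (fst (X, t * X) * snd (1::real, 1::real) - snd (X, t * X) * fst (1::real, 1::real)) \<in> \<int>"
    using L W(1) unfolding coord_lattice_def by blast
  then have "real D * (X * (1 - t)) \<in> \<int>" by (simp add: algebra_simps)
  then obtain m where m: "real D * (X * (1 - t)) = of_int m" by (auto elim: Ints_cases)
  have "g ` {0<..<D} \<subseteq> {0<..<m}"
  proof
    fix k assume "k \<in> g ` {0<..<D}"
    then obtain h where h: "h \<in> {0<..<D}" "k = g h" by auto
    have eq: "G h = (real D * X) * (y h - t * (h / D))" by (simp add: G_def algebra_simps)
    have DX: "0 < real D * X" using D W by simp
    have "0 < G h" using mult_pos_pos[OF DX, of "y h - t * (h / D)"] y[OF h(1)] unfolding eq by simp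
    moreover have "G h < (real D * X) * (1 - t)"
      unfolding eq using y[OF h(1)] DX by (intro mult_strict_left_mono) auto
    ultimately have "0 < real_of_int k" "real_of_int k < of_int m"
      using gG[OF h(1)] m h(2) by (auto simp: mult.assoc)
    then show "k \<in> {0<..<m}" by simp
  qed
  moreover have "inj_on g {0<..<D}"
  proof (rule inj_onI)
    have False if "g h = g k" "h \<in> {0<..<D}" "k \<in> {0<..<D}" "h < k" for h k
    proof -
      have "G h = G k" using that gG by metis
      then have "(real D * X) * (y h - t * (h / D)) = (real D * X) * (y k - t * (k / D))"
        by (simp add: G_def algebra_simps)
      then have "y h - t * (h / D) = y k - t * (k / D)" using D W by simp
      then have *: "y k - y h = t * (k / D - h / D)" by (simp add: algebra_simps)
      have "(real k / D, y k) - (real h / D, y h) \<in> L"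
        using coord_lattice_diff[OF L] y that by blast
      moreover have "0 < real k / D - h / D" "real k / D - h / D < 1"
        using that D by (auto simp: field_simps)
      ultimately show False using dir[of "(real k / D, y k) - (real h / D, y h)"] * by simp
    qed
    then show "h = k" if "h \<in> {0<..<D}" "k \<in> {0<..<D}" "g h = g k" for h k
      using that by (metis linorder_less_linear)
  qed
  ultimately have "card {0<..<D} \<le> card {0<..<m}" by (intro card_inj_on_le) auto
  then have "int D \<le> m" using D by simp
  then have "real D \<le> real D * (X * (1 - t))" unfolding m by linarith
  then show ?thesis using D by simp
qed

text \<open>The contradiction when both strips are free of lattice points, in the normalized situation: the
  lower chord of \<open>Q\<close> is at least as long as the upper one, and the upper edge of \<open>P\<close> in its strip,
  from \<open>a\<close> to \<open>b\<close>, has slope \<open>t \<ge> 0\<close>. The points \<open>A\<close> and \<open>B\<close> lie on the edge of \<open>Q\<close>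
  with the same outer normal \<open>(- t, 1)\<close>.\<close>

lemma no_lattice_free_strips_rising_edge:
  assumes L: "coord_lattice L D"
    and P: "convex P" "(0, 0) \<in> P" "(1, 0) \<in> P"
    and Q: "convex Q" "(0, 0) \<in> Q" "(0, 1) \<in> Q"
    and freeP: "\<And>w. w \<in> L \<inter> P \<Longrightarrow> \<not> (0 < fst w \<and> fst w < 1)"
    and freeQ: "\<And>w. w \<in> L \<inter> Q \<Longrightarrow> \<not> (0 < snd w \<and> snd w < 1)"
    and t: "0 \<le> t"
    and maxP: "\<And>z. z \<in> P \<Longrightarrow> snd z - t * fst z \<le> k"
    and a: "a \<in> L \<inter> P" "fst a \<le> 0" "snd a - t * fst a = k"
    and b: "b \<in> L \<inter> P" "1 \<le> fst b" "snd b - t * fst b = k"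
    and maxQ: "\<And>z. z \<in> Q \<Longrightarrow> snd z - t * fst z \<le> m"
    and A: "A \<in> L \<inter> Q" "snd A - t * fst A = m"
    and B: "B \<in> L \<inter> Q" "snd B - t * fst B = m" and AB: "A \<noteq> B"
    and chord0: "(l0, 0) \<in> Q" "(r0, 0) \<in> Q" "\<And>x. (x, 0) \<in> Q \<Longrightarrow> l0 \<le> x \<and> x \<le> r0"
    and chord1: "(l1, 1) \<in> Q" "(r1, 1) \<in> Q" "\<And>x. (x, 1) \<in> Q \<Longrightarrow> l1 \<le> x \<and> x \<le> r1"
    and wide: "r1 - l1 \<le> r0 - l0"
  shows False
proof -
  have D: "2 \<le> D" using L by (simp add: coord_lattice_def)
  have not1: "(1, 1) \<notin> Q"
    using lattice_point_in_triangle[OF L Q] freeQ by blast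
  have not2: "(- 1, 0) \<notin> Q"
  proof
    assume h: "(- 1, 0) \<in> Q"
    have "(x, 1 / D) \<in> Q" if "x \<le> 0" "1 / D - 1 \<le> x" for x
      by (rule convex_triangle_pair[of Q 0 0 "-1" 0 0 1 "1 - 1/D + x" "-x" "1/D"])
        (use Q h that in \<open>auto\<close>)
    moreover have "(x, 1 - 1 / D) \<in> Q" if "x \<le> 0" "- (1 / D) \<le> x" for x
      by (rule convex_triangle_pair[of Q 0 0 "-1" 0 0 1 "1/D + x" "-x" "1 - 1/D"])
        (use Q h that D in \<open>auto\<close>)
    moreover obtain x where x: "(x, 1 / D) \<in> L" "- 1 \<le> x" "x < 0"
      using coord_lattice_row_point[OF L, of 1 "-1"] by auto
    moreover have "(-1, 1) \<in> L" using coord_lattice_diff[OF L, of "(0,1)" "(1,0)"] L by (auto simp: coord_lattice_def)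
    then have "(-1 - x, 1 - 1 / D) \<in> L" using coord_lattice_diff[OF L _ x(1), of "(-1,1)"] by simp
    ultimately have "(x, 1 / D) \<in> L \<inter> Q \<or> (-1 - x, 1 - 1 / D) \<in> L \<inter> Q"
      by (cases "1 / D - 1 \<le> x") auto
    then show False
      using freeQ[of "(x, 1 / D)"] freeQ[of "(-1 - x, 1 - 1 / D)"] D by auto
  qed
  have ab: "(x, k + t * x) \<in> P" if "fst a \<le> x" "x \<le> fst b" for x
  proof -
    define s where "s = (x - fst a) / (fst b - fst a)"
    have "fst b - fst a > 0" using a b by linarith
    then have s: "0 \<le> s" "s \<le> 1" "s * (fst b - fst a) = x - fst a"
      using that by (auto simp: s_def)
    have "snd b - snd a = t * (fst b - fst a)" using a b by (simp add: algebra_simps)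
    then have "s * (snd b - snd a) = t * (x - fst a)" using s by (metis mult.left_commute)
    then have eq: "k + t * x = snd a + s * (snd b - snd a)"
      using a(3) by (simp add: algebra_simps)
    show ?thesis
      by (rule convex_segment_pair[of P "fst a" "snd a" "fst b" "snd b" s])
        (use eq a(1) b(1) P(1) s in \<open>auto\<close>)
  qed
  have k0: "0 \<le> k" using maxP[OF P(2)] by simp
  have not3: "(1, 1) \<notin> P"
  proof
    assume "(1, 1) \<in> P"
    moreover have "convex {(x, y). (y, x) \<in> P}"
    proof (rule convexI)
      fix x y :: "real \<times> real" and u v :: real
      assume "x \<in> {(x, y). (y, x) \<in> P}" "y \<in> {(x, y). (y, x) \<in> P}" "0 \<le> u" "0 \<le> v" "u + v = 1"
      then show "u *\<^sub>R x + v *\<^sub>R y \<in> {(x, y). (y, x) \<in> P}"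
        using convexD[OF P(1), of "(snd x, fst x)" "(snd y, fst y)" u v] by (simp add: case_prod_beta)
    qed
    ultimately obtain w where "w \<in> {(x, y). (y, x) \<in> L} \<inter> {(x, y). (y, x) \<in> P}" "0 < snd w" "snd w < 1"
      using lattice_point_in_triangle[OF coord_lattice_swap[OF L], of "{(x, y). (y, x) \<in> P}"] P by auto
    then show False using freeP[of "(snd w, fst w)"] by auto
  qed
  have one: "(1, k + t) \<in> P" using ab[of 1] a b by simp
  have "t < 1"
  proof (rule ccontr)
    assume h: "\<not> t < 1"
    have "(1, 1) \<in> P"
      by (rule convex_segment_pair[of P 1 0 1 "k + t" "1 / (k + t)"])
        (use h one P k0 in \<open>auto\<close>)
    then show False using not3 by simp
  qed
  have tP: "(1, t) \<in> P"
  proof (cases "t = 0")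
    case False
    show ?thesis
      by (rule convex_segment_pair[of P 1 0 1 "k + t" "t / (k + t)"])
        (use False one P k0 t in \<open>auto\<close>)
  qed (use P in auto)
  have dir: "\<not> (0 < fst w \<and> fst w < 1)" if w: "w \<in> L" "snd w = t * fst w" for w
  proof
    assume w1: "0 < fst w \<and> fst w < 1"
    \<comment> \<open>If \<open>w\<close> were that short, \<open>a + j w\<close> would be a lattice point of the edge in the open strip.\<close>
    define j where "j = \<lfloor>- fst a / fst w\<rfloor> + 1"
    have "- fst a / fst w < j" "j \<le> - fst a / fst w + 1" unfolding j_def by linarith+
    then have j: "0 < fst a + j * fst w" "fst a + j * fst w \<le> fst w"
      using w1 by (auto simp: field_simps)
    have "a + of_int j *\<^sub>R w \<in> L"
      using coord_lattice_add[OF L _ coord_lattice_int_mult[OF L w(1)]] a by blast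
    moreover have "a + of_int j *\<^sub>R w = (fst a + j * fst w, k + t * (fst a + j * fst w))"
      using a(3) w(2) by (simp add: prod_eq_iff algebra_simps)
    moreover have "(fst a + j * fst w, k + t * (fst a + j * fst w)) \<in> P"
      using ab[of "fst a + j * fst w"] j a b w1 by linarith
    ultimately show False using freeP[of "a + of_int j *\<^sub>R w"] j w1 by auto
  qed
  have main: False if A: "A \<in> L \<inter> Q" "snd A - t * fst A = m"
    and B: "B \<in> L \<inter> Q" "snd B - t * fst B = m" and lt: "fst A < fst B" for A B
  proof -
    define X where "X = fst B - fst A"
    have X: "0 < X" "snd B - snd A = t * X" using A B lt by (auto simp: X_def algebra_simps)
    have "B - A \<in> L" using coord_lattice_diff[OF L] A B by blast
    then have "(X, t * X) \<in> L" using X unfolding X_def by (simp add: prod_eq_iff minus_prod_def)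
    then have key: "1 \<le> X * (1 - t)"
      using lattice_slope_bound[OF L P tP t \<open>t < 1\<close> freeP dir] X by blast
    \<comment> \<open>A maximizer of \<open>y - t x\<close> below the strip is so far to the left that \<open>(-1, 0)\<close> is in \<open>Q\<close>.\<close>
    have yA: "1 \<le> snd A"
    proof (rule ccontr)
      assume "\<not> 1 \<le> snd A"
      then have y0: "snd A \<le> 0" using freeQ[OF A(1)] by linarith
      have "1 \<le> snd A - t * fst A" using maxQ[OF Q(3)] A by simp
      then have 1: "t * fst A \<le> snd A - 1" by simp
      then have "t * fst A < 0" using y0 by linarith
      then have "fst A < 0" using t by (simp add: mult_less_0_iff)
      then have "fst A \<le> t * fst A" using \<open>t < 1\<close> by (simp add: mult_le_cancel_right1)
      then have 2: "fst A \<le> snd A - 1" using 1 by simp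
      define z where "z = fst A / (1 - snd A)"
      have z: "z \<le> -1" using 2 y0 by (simp add: z_def field_simps)
      have zQ: "(z, 0) \<in> Q"
        by (rule convex_segment_pair[of Q 0 1 "fst A" "snd A" "1 / (1 - snd A)"])
          (use Q A(1) y0 in \<open>auto simp: z_def field_simps\<close>)
      have "(-1, 0) \<in> Q"
        by (rule convex_segment_pair[of Q 0 0 z 0 "-1 / z"])
          (use Q zQ z in \<open>auto simp: divide_le_eq le_divide_eq\<close>)
      then show False using not2 by simp
    qed
    have yB: "snd A \<le> snd B" using X t by (metis diff_ge_0_iff_ge less_eq_real_def mult_nonneg_nonneg)
    have r0: "0 \<le> r0" using chord0(3)[OF Q(2)] by simp
    have r10: "0 \<le> r1" using chord1(3)[OF Q(3)] by simp
    have r1: "r1 < 1"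
    proof (rule ccontr)
      assume h: "\<not> r1 < 1"
      have "(1, 1) \<in> Q"
        by (rule convex_segment_pair[of Q 0 1 r1 1 "1 / r1"])
          (use h Q chord1(2) in \<open>auto\<close>)
      then show False using not1 by simp
    qed
    \<comment> \<open>Otherwise both chords, hence the chord at height \<open>1/D\<close>, have length at least 1.\<close>
    have c1: "r1 - l1 < 1"
    proof (rule ccontr)
      assume h: "\<not> r1 - l1 < 1"
      define l r where "l = l0 + (1 / D) * (l1 - l0)" and "r = r0 + (1 / D) * (r1 - r0)"
      have lQ: "(l, 1 / D) \<in> Q" unfolding l_def
        by (rule convex_segment_pair[of Q l0 0 l1 1 "1 / D"])
          (use Q chord0 chord1 D in \<open>auto\<close>)
      have rQ: "(r, 1 / D) \<in> Q" unfolding r_def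
        by (rule convex_segment_pair[of Q r0 0 r1 1 "1 / D"])
          (use Q chord0 chord1 D in \<open>auto\<close>)
      have "r - l = (1 - 1 / D) * (r0 - l0) + (1 / D) * (r1 - l1)"
        by (simp add: r_def l_def algebra_simps diff_divide_distrib)
      moreover have "(1 - 1 / D) * 1 \<le> (1 - 1 / D) * (r0 - l0)"
        using h wide D by (intro mult_left_mono) auto
      moreover have "(1 / D) * 1 \<le> (1 / D) * (r1 - l1)"
        using h D by (intro mult_left_mono) auto
      ultimately have lr: "l + 1 \<le> r" by simp
      obtain x where x: "(x, 1 / D) \<in> L" "l \<le> x" "x < l + 1"
        using coord_lattice_row_point[OF L, of 1 l] by auto
      have "(x, 1 / D) \<in> Q"
        by (rule convex_segment_pair[of Q l "1/D" r "1/D" "(x - l) / (r - l)"])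
          (use Q(1) lQ rQ x lr in \<open>auto\<close>)
      then show False using freeQ[of "(x, 1 / D)"] x D by auto
    qed
    \<comment> \<open>\<open>Q\<close> lies above height 1 between the lines through the end points of the two chords.\<close>
    have Bx: "fst B \<le> r0 + (r1 - r0) * snd B"
    proof -
      have "(r0 + (1 / snd B) * (fst B - r0), 1) \<in> Q"
        by (rule convex_segment_pair[of Q r0 0 "fst B" "snd B" "1 / snd B"])
          (use Q(1) B(1) chord0(2) yA yB in \<open>auto\<close>)
      then have "r0 + (1 / snd B) * (fst B - r0) \<le> r1" using chord1(3) by blast
      then show ?thesis using yA yB by (simp add: field_simps)
    qed
    have Ax: "l0 + (l1 - l0) * snd A \<le> fst A"
    proof -
      have "(l0 + (1 / snd A) * (fst A - l0), 1) \<in> Q"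
        by (rule convex_segment_pair[of Q l0 0 "fst A" "snd A" "1 / snd A"])
          (use Q(1) A(1) chord0(1) yA in \<open>auto\<close>)
      then have "l1 \<le> l0 + (1 / snd A) * (fst A - l0)" using chord1(3) by blast
      then show ?thesis using yA by (simp add: field_simps)
    qed
    define p where "p = (r1 - r0) * (snd B - snd A)"
    define n where "n = ((r1 - r0) - (l1 - l0)) * snd A"
    have "X \<le> (r0 - l0) + p + n"
      using Ax Bx unfolding X_def p_def n_def by (simp add: algebra_simps)
    moreover have "n \<le> ((r1 - r0) - (l1 - l0)) * 1"
      unfolding n_def using wide yA by (intro mult_left_mono_neg) auto
    moreover have "p \<le> 1 * (snd B - snd A)"
      unfolding p_def using r1 r0 yB by (intro mult_right_mono) auto
    ultimately have "X < 1 + (snd B - snd A)" using c1 unfolding mult_1 mult_1_right by linarith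
    then show False using key X(2) by (simp add: algebra_simps)
  qed
  have "fst A \<noteq> fst B"
    using A B AB by (auto simp: prod_eq_iff)
  then show False using main[of A B] main[of B A] A B by linarith
qed

text \<open>The sign of the slope is irrelevant, by the reflection that exchanges the points \<open>(0, 0)\<close> and \<open>(1, 0)\<close> of
  \<open>P\<close>: it acts as \<open>x \<mapsto> 1 - x\<close> on \<open>P\<close> and as \<open>x \<mapsto> - x\<close> on \<open>Q\<close>.\<close>

lemma no_lattice_free_strips_upper_edge:
  assumes L: "coord_lattice L D"
    and P: "convex P" "(0, 0) \<in> P" "(1, 0) \<in> P"
    and Q: "convex Q" "(0, 0) \<in> Q" "(0, 1) \<in> Q"
    and freeP: "\<And>w. w \<in> L \<inter> P \<Longrightarrow> \<not> (0 < fst w \<and> fst w < 1)"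
    and freeQ: "\<And>w. w \<in> L \<inter> Q \<Longrightarrow> \<not> (0 < snd w \<and> snd w < 1)"
    and maxP: "\<And>z. z \<in> P \<Longrightarrow> snd z - t * fst z \<le> k"
    and a: "a \<in> L \<inter> P" "fst a \<le> 0" "snd a - t * fst a = k"
    and b: "b \<in> L \<inter> P" "1 \<le> fst b" "snd b - t * fst b = k"
    and maxQ: "\<And>z. z \<in> Q \<Longrightarrow> snd z - t * fst z \<le> m"
    and A: "A \<in> L \<inter> Q" "snd A - t * fst A = m"
    and B: "B \<in> L \<inter> Q" "snd B - t * fst B = m" and AB: "A \<noteq> B"
    and chord0: "(l0, 0) \<in> Q" "(r0, 0) \<in> Q" "\<And>x. (x, 0) \<in> Q \<Longrightarrow> l0 \<le> x \<and> x \<le> r0"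
    and chord1: "(l1, 1) \<in> Q" "(r1, 1) \<in> Q" "\<And>x. (x, 1) \<in> Q \<Longrightarrow> l1 \<le> x \<and> x \<le> r1"
    and wide: "r1 - l1 \<le> r0 - l0"
  shows False
proof (cases "0 \<le> t")
  case True
  show False
    by (rule no_lattice_free_strips_rising_edge[OF L P Q freeP freeQ True maxP a b maxQ A B AB chord0 chord1 wide])
next
  case False
  define L' P' Q' where "L' = {(x, y). (- x, y) \<in> L}" and "P' = {(x, y). (1 - x, y) \<in> P}"
    and "Q' = {(x, y). (- x, y) \<in> Q}"
  have "(1, 0) \<in> L" using L by (simp add: coord_lattice_def)
  then have shift: "(1 - x, y) \<in> L \<longleftrightarrow> (- x, y) \<in> L" for x y
    using coord_lattice_add[OF L, of "(1,0)" "(- x, y)"] coord_lattice_diff[OF L, of "(1 - x, y)" "(1,0)"]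
    by auto
  have L': "coord_lattice L' D"
  proof -
    have "real D * (fst r * snd s - snd r * fst s) \<in> \<int>"
      if "(- fst r, snd r) \<in> L" "(- fst s, snd s) \<in> L" for r s
    proof -
      have "real D * (- fst r * snd s - snd r * - fst s) \<in> \<int>"
        using L that unfolding coord_lattice_def by fastforce
      then have "- (real D * (- fst r * snd s - snd r * - fst s)) \<in> \<int>" by (rule Ints_minus)
      then show ?thesis by (simp add: algebra_simps)
    qed
    moreover have "r - s \<in> L'" if "r \<in> L'" "s \<in> L'" for r s
      using coord_lattice_diff[OF L, of "(- fst r, snd r)" "(- fst s, snd s)"] that
      by (simp add: L'_def case_prod_beta)
    moreover have "(-1, 0) \<in> L" using coord_lattice_uminus[OF L \<open>(1, 0) \<in> L\<close>] by simp
    moreover obtain x where "(x, 1 / D) \<in> L" using L by (auto simp: coord_lattice_def)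
    then have "(- (- x), 1 / D) \<in> L" by simp
    moreover obtain y where "(1 / D, y) \<in> L" using L by (auto simp: coord_lattice_def)
    then have "(- (1 / D), - y) \<in> L" using coord_lattice_uminus[OF L] by fastforce
    ultimately show ?thesis
      using L unfolding coord_lattice_def L'_def
      by (auto simp only: case_prod_beta mem_Collect_eq fst_conv snd_conv minus_zero)
  qed
  have P': "convex P'"
  proof (rule convexI)
    fix x y :: "real \<times> real" and u v :: real
    assume "x \<in> P'" "y \<in> P'" "0 \<le> u" "0 \<le> v" and uv: "u + v = 1"
    then have "u *\<^sub>R (1 - fst x, snd x) + v *\<^sub>R (1 - fst y, snd y) \<in> P"
      by (intro convexD[OF P(1)]) (auto simp: P'_def case_prod_beta)
    moreover have "u * (1 - fst x) + v * (1 - fst y) = 1 - (u * fst x + v * fst y)"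
      using uv by (simp add: algebra_simps)
    ultimately show "u *\<^sub>R x + v *\<^sub>R y \<in> P'"
      by (simp add: P'_def case_prod_beta)
  qed
  have Q': "convex Q'"
  proof (rule convexI)
    fix x y :: "real \<times> real" and u v :: real
    assume "x \<in> Q'" "y \<in> Q'" "0 \<le> u" "0 \<le> v" "u + v = 1"
    then have "u *\<^sub>R (- fst x, snd x) + v *\<^sub>R (- fst y, snd y) \<in> Q"
      by (intro convexD[OF Q(1)]) (auto simp: Q'_def case_prod_beta)
    then show "u *\<^sub>R x + v *\<^sub>R y \<in> Q'"
      by (simp add: Q'_def case_prod_beta algebra_simps)
  qed
  show False
  proof (rule no_lattice_free_strips_rising_edge[OF L' P' _ _ Q', where t = "- t" and k = "k + t" and m = m
        and a = "(1 - fst b, snd b)" and b = "(1 - fst a, snd a)"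
        and A = "(- fst A, snd A)" and B = "(- fst B, snd B)"
        and ?l0.0 = "- r0" and ?r0.0 = "- l0" and ?l1.0 = "- r1" and ?r1.0 = "- l1"])
    show "\<not> (0 < fst w \<and> fst w < 1)" if "w \<in> L' \<inter> P'" for w
      using that freeP[of "(1 - fst w, snd w)"] shift by (auto simp: L'_def P'_def)
    show "\<not> (0 < snd w \<and> snd w < 1)" if "w \<in> L' \<inter> Q'" for w
      using that freeQ[of "(- fst w, snd w)"] by (auto simp: L'_def Q'_def)
    show "snd z - - t * fst z \<le> k + t" if "z \<in> P'" for z
      using that maxP[of "(1 - fst z, snd z)"] by (auto simp: P'_def algebra_simps)
    show "snd z - - t * fst z \<le> m" if "z \<in> Q'" for z
      using that maxQ[of "(- fst z, snd z)"] by (auto simp: Q'_def algebra_simps)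
    show "- r0 \<le> x \<and> x \<le> - l0" if "(x, 0) \<in> Q'" for x
      using that chord0(3)[of "- x"] by (auto simp: Q'_def)
    show "- r1 \<le> x \<and> x \<le> - l1" if "(x, 1) \<in> Q'" for x
      using that chord1(3)[of "- x"] by (auto simp: Q'_def)
    show "(1 - fst b, snd b) \<in> L' \<inter> P'" using b shift[of "1 - fst b" "snd b"] by (simp add: L'_def P'_def)
    show "(1 - fst a, snd a) \<in> L' \<inter> P'" using a shift[of "1 - fst a" "snd a"] by (simp add: L'_def P'_def)
    show "(- fst A, snd A) \<in> L' \<inter> Q'" using A by (simp add: L'_def Q'_def)
    show "(- fst B, snd B) \<in> L' \<inter> Q'" using B by (simp add: L'_def Q'_def)
    show "(- fst A, snd A) \<noteq> (- fst B, snd B)" using AB by (simp add: prod_eq_iff)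
  qed (use P Q a b A B chord0 chord1 wide False in
        \<open>auto simp: P'_def Q'_def algebra_simps\<close>)
qed

text \<open>If the upper chord is at least as long as the lower one, the lower edge of \<open>P\<close> takes over the role
  of the upper edge,
  by the reflection that exchanges the points \<open>(0, 0)\<close> and \<open>(0, 1)\<close> of \<open>Q\<close>: it acts as
  \<open>y \<mapsto> - y\<close> on \<open>P\<close> and as
  \<open>y \<mapsto> 1 - y\<close> on \<open>Q\<close>.\<close>

lemma no_lattice_free_strips_lower_edge:
  assumes L: "coord_lattice L D"
    and P: "convex P" "(0, 0) \<in> P" "(1, 0) \<in> P"
    and Q: "convex Q" "(0, 0) \<in> Q" "(0, 1) \<in> Q"
    and freeP: "\<And>w. w \<in> L \<inter> P \<Longrightarrow> \<not> (0 < fst w \<and> fst w < 1)"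
    and freeQ: "\<And>w. w \<in> L \<inter> Q \<Longrightarrow> \<not> (0 < snd w \<and> snd w < 1)"
    and maxP: "\<And>z. z \<in> P \<Longrightarrow> - snd z - t * fst z \<le> k"
    and a: "a \<in> L \<inter> P" "fst a \<le> 0" "- snd a - t * fst a = k"
    and b: "b \<in> L \<inter> P" "1 \<le> fst b" "- snd b - t * fst b = k"
    and maxQ: "\<And>z. z \<in> Q \<Longrightarrow> - snd z - t * fst z \<le> m"
    and A: "A \<in> L \<inter> Q" "- snd A - t * fst A = m"
    and B: "B \<in> L \<inter> Q" "- snd B - t * fst B = m" and AB: "A \<noteq> B"
    and chord0: "(l0, 0) \<in> Q" "(r0, 0) \<in> Q" "\<And>x. (x, 0) \<in> Q \<Longrightarrow> l0 \<le> x \<and> x \<le> r0"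
    and chord1: "(l1, 1) \<in> Q" "(r1, 1) \<in> Q" "\<And>x. (x, 1) \<in> Q \<Longrightarrow> l1 \<le> x \<and> x \<le> r1"
    and wide: "r0 - l0 \<le> r1 - l1"
  shows False
proof -
  define L' P' Q' where "L' = {(x, y). (x, - y) \<in> L}" and "P' = {(x, y). (x, - y) \<in> P}"
    and "Q' = {(x, y). (x, 1 - y) \<in> Q}"
  have "(0, 1) \<in> L" using L by (simp add: coord_lattice_def)
  then have shift: "(x, 1 - y) \<in> L \<longleftrightarrow> (x, - y) \<in> L" for x y
    using coord_lattice_add[OF L, of "(0,1)" "(x, - y)"] coord_lattice_diff[OF L, of "(x, 1 - y)" "(0,1)"]
    by auto
  have L': "coord_lattice L' D"
  proof -
    have "real D * (fst r * snd s - snd r * fst s) \<in> \<int>"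
      if "(fst r, - snd r) \<in> L" "(fst s, - snd s) \<in> L" for r s
    proof -
      have "real D * (fst r * - snd s - - snd r * fst s) \<in> \<int>"
        using L that unfolding coord_lattice_def by fastforce
      then have "- (real D * (fst r * - snd s - - snd r * fst s)) \<in> \<int>" by (rule Ints_minus)
      then show ?thesis by (simp add: algebra_simps)
    qed
    moreover have "r - s \<in> L'" if "r \<in> L'" "s \<in> L'" for r s
      using coord_lattice_diff[OF L, of "(fst r, - snd r)" "(fst s, - snd s)"] that
      by (simp add: L'_def case_prod_beta)
    moreover have "(0, -1) \<in> L" using coord_lattice_uminus[OF L \<open>(0, 1) \<in> L\<close>] by simp
    moreover obtain y where "(1 / D, y) \<in> L" using L by (auto simp: coord_lattice_def)
    then have "(1 / D, - (- y)) \<in> L" by simp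
    moreover obtain x where "(x, 1 / D) \<in> L" using L by (auto simp: coord_lattice_def)
    then have "(- x, - (1 / D)) \<in> L" using coord_lattice_uminus[OF L] by fastforce
    ultimately show ?thesis
      using L unfolding coord_lattice_def L'_def
      by (auto simp only: case_prod_beta mem_Collect_eq fst_conv snd_conv minus_zero)
  qed
  have P': "convex P'"
  proof (rule convexI)
    fix x y :: "real \<times> real" and u v :: real
    assume "x \<in> P'" "y \<in> P'" "0 \<le> u" "0 \<le> v" "u + v = 1"
    then have "u *\<^sub>R (fst x, - snd x) + v *\<^sub>R (fst y, - snd y) \<in> P"
      by (intro convexD[OF P(1)]) (auto simp: P'_def case_prod_beta)
    then show "u *\<^sub>R x + v *\<^sub>R y \<in> P'"
      by (simp add: P'_def case_prod_beta algebra_simps)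
  qed
  have Q': "convex Q'"
  proof (rule convexI)
    fix x y :: "real \<times> real" and u v :: real
    assume "x \<in> Q'" "y \<in> Q'" "0 \<le> u" "0 \<le> v" and uv: "u + v = 1"
    then have "u *\<^sub>R (fst x, 1 - snd x) + v *\<^sub>R (fst y, 1 - snd y) \<in> Q"
      by (intro convexD[OF Q(1)]) (auto simp: Q'_def case_prod_beta)
    moreover have "u * (1 - snd x) + v * (1 - snd y) = 1 - (u * snd x + v * snd y)"
      using uv by (simp add: algebra_simps)
    ultimately show "u *\<^sub>R x + v *\<^sub>R y \<in> Q'"
      by (simp add: Q'_def case_prod_beta)
  qed
  show False
  proof (rule no_lattice_free_strips_upper_edge[OF L' P' _ _ Q', where t = t and k = k and m = "m + 1"
        and a = "(fst a, - snd a)" and b = "(fst b, - snd b)"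
        and A = "(fst A, 1 - snd A)" and B = "(fst B, 1 - snd B)"
        and ?l0.0 = "l1" and ?r0.0 = "r1" and ?l1.0 = "l0" and ?r1.0 = "r0"])
    show "\<not> (0 < fst w \<and> fst w < 1)" if "w \<in> L' \<inter> P'" for w
      using that freeP[of "(fst w, - snd w)"] by (auto simp: L'_def P'_def)
    show "\<not> (0 < snd w \<and> snd w < 1)" if "w \<in> L' \<inter> Q'" for w
      using that freeQ[of "(fst w, 1 - snd w)"] shift by (auto simp: L'_def Q'_def)
    show "snd z - t * fst z \<le> k" if "z \<in> P'" for z
      using that maxP[of "(fst z, - snd z)"] by (auto simp: P'_def algebra_simps)
    show "snd z - t * fst z \<le> m + 1" if "z \<in> Q'" for z
      using that maxQ[of "(fst z, 1 - snd z)"] by (auto simp: Q'_def algebra_simps)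
    show "l1 \<le> x \<and> x \<le> r1" if "(x, 0) \<in> Q'" for x
      using that chord1(3)[of x] by (auto simp: Q'_def)
    show "l0 \<le> x \<and> x \<le> r0" if "(x, 1) \<in> Q'" for x
      using that chord0(3)[of x] by (auto simp: Q'_def)
    show "(fst A, 1 - snd A) \<in> L' \<inter> Q'" using A shift[of "fst A" "1 - snd A"] by (simp add: L'_def Q'_def)
    show "(fst B, 1 - snd B) \<in> L' \<inter> Q'" using B shift[of "fst B" "1 - snd B"] by (simp add: L'_def Q'_def)
    show "(fst a, - snd a) \<in> L' \<inter> P'" using a by (simp add: L'_def P'_def)
    show "(fst b, - snd b) \<in> L' \<inter> P'" using b by (simp add: L'_def P'_def)
    show "(fst A, 1 - snd A) \<noteq> (fst B, 1 - snd B)" using AB by (simp add: prod_eq_iff)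
  qed (use P Q a b A B chord0 chord1 wide in
        \<open>auto simp: P'_def Q'_def algebra_simps\<close>)
qed

text \<open>A finite set without points over the open interval \<open>(0, 1)\<close>, but with points on both sides, has a
  supporting line from above that touches it on both sides: among the segments from the left to the
  right part take one whose intersection \<open>h\<close> with \<open>x = 1/2\<close> is highest.\<close>

lemma upper_crossing_edge:
  fixes S :: "(real \<times> real) set"
  assumes "finite S" and split: "\<And>s. s \<in> S \<Longrightarrow> fst s \<le> 0 \<or> 1 \<le> fst s"
    and "s0 \<in> S" "fst s0 \<le> 0" "s1 \<in> S" "1 \<le> fst s1"
  obtains t k a b where "a \<in> S" "fst a \<le> 0" "snd a - t * fst a = k"
    "b \<in> S" "1 \<le> fst b" "snd b - t * fst b = k" "\<And>s. s \<in> S \<Longrightarrow> snd s - t * fst s \<le> k"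
proof -
  define T where "T = {s\<in>S. fst s \<le> 0} \<times> {s\<in>S. 1 \<le> fst s}"
  define h :: "(real \<times> real) \<times> (real \<times> real) \<Rightarrow> real" where
    "h z = ((fst (snd z) - 1/2) * snd (fst z) + (1/2 - fst (fst z)) * snd (snd z)) /
           (fst (snd z) - fst (fst z))" for z
  have "(s0, s1) \<in> T" using assms by (simp add: T_def)
  moreover have "finite T" using assms(1) by (simp add: T_def)
  ultimately have "finite T" "T \<noteq> {}" by blast+
  then obtain z where z: "z \<in> T" and zmax: "\<And>y. y \<in> T \<Longrightarrow> h y \<le> h z"
    using Max_in[of "h ` T"] Max_ge[of "h ` T"] by (metis (no_types, lifting) finite_imageI image_iff image_is_empty)
  obtain a b where zab: "z = (a, b)" by (cases z)
  have a: "a \<in> S" "fst a \<le> 0" and b: "b \<in> S" "1 \<le> fst b" using z zab by (auto simp: T_def)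
  define t where "t = (snd b - snd a) / (fst b - fst a)"
  define k where "k = snd a - t * fst a"
  have ab: "fst b - fst a > 0" using a b by linarith
  have t: "t * (fst b - fst a) = snd b - snd a" using ab by (simp add: t_def)
  have ka: "snd a = k + t * fst a" and kb: "snd b = k + t * fst b" using t by (simp_all add: k_def algebra_simps)
  have hz: "h z = k + t / 2"
  proof -
    have "(fst b - 1/2) * (k + t * fst a) + (1/2 - fst a) * (k + t * fst b) = (k + t / 2) * (fst b - fst a)"
      by (simp add: field_simps)
    then show ?thesis using ab unfolding h_def zab by (simp add: ka kb)
  qed
  have bound: "snd s - t * fst s \<le> k" if s: "s \<in> S" for s
  proof (cases "fst s \<le> 0")
    case True
    then have "(s, b) \<in> T" using s b by (simp add: T_def)
    then have "h (s, b) \<le> k + t / 2" using zmax hz by metis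
    moreover have d: "0 < fst b - fst s" using True b by linarith
    ultimately have "(fst b - 1/2) * snd s + (1/2 - fst s) * (k + t * fst b) \<le> (k + t / 2) * (fst b - fst s)"
      unfolding h_def by (simp add: kb divide_le_eq)
    then have "(fst b - 1/2) * (snd s - t * fst s - k) \<le> 0" by (simp add: algebra_simps diff_divide_distrib)
    then show ?thesis using b(2) by (simp add: mult_le_0_iff)
  next
    case False
    then have f: "1 \<le> fst s" using split[OF s] by simp
    then have "(a, s) \<in> T" using s a by (simp add: T_def)
    then have "h (a, s) \<le> k + t / 2" using zmax hz by metis
    moreover have d: "0 < fst s - fst a" using f a by linarith
    ultimately have "(fst s - 1/2) * (k + t * fst a) + (1/2 - fst a) * snd s \<le> (k + t / 2) * (fst s - fst a)"
      unfolding h_def by (simp add: ka divide_le_eq)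
    then have "(1/2 - fst a) * (snd s - t * fst s - k) \<le> 0" by (simp add: algebra_simps diff_divide_distrib)
    then show ?thesis using a(2) by (simp add: mult_le_0_iff)
  qed
  show thesis
    by (rule that[of a t k b]) (use a b ka kb bound in auto)
qed

lemma hull_pair_bound:
  fixes S :: "(real \<times> real) set"
  assumes "\<And>s. s \<in> S \<Longrightarrow> \<alpha> * fst s + \<beta> * snd s \<le> k" "z \<in> convex hull S"
  shows "\<alpha> * fst z + \<beta> * snd z \<le> k"
proof -
  have "{z. (\<alpha>, \<beta>) \<bullet> z \<le> k} = {z. \<alpha> * fst z + \<beta> * snd z \<le> k}"
    by (auto simp: inner_prod_def)
  then have "convex {z :: real \<times> real. \<alpha> * fst z + \<beta> * snd z \<le> k}"
    using convex_halfspace_le[of "(\<alpha>, \<beta>)" k] by simp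
  then have "convex hull S \<subseteq> {z. \<alpha> * fst z + \<beta> * snd z \<le> k}"
    by (intro hull_minimal) (use assms(1) in auto)
  then show ?thesis using assms(2) by auto
qed

lemma horizontal_chord:
  fixes Q :: "(real \<times> real) set"
  assumes "compact Q" "(x0, y) \<in> Q"
  obtains l r where "(l, y) \<in> Q" "(r, y) \<in> Q" "\<And>x. (x, y) \<in> Q \<Longrightarrow> l \<le> x \<and> x \<le> r"
proof -
  have c: "compact (Q \<inter> {z. snd z = y})"
    by (intro compact_Int_closed assms closed_Collect_eq continuous_intros)
  have ne: "Q \<inter> {z. snd z = y} \<noteq> {}" using assms by auto
  have cont: "continuous_on (Q \<inter> {z. snd z = y}) fst" by (intro continuous_intros)
  obtain u where u: "u \<in> Q \<inter> {z. snd z = y}" "\<And>z. z \<in> Q \<inter> {z. snd z = y} \<Longrightarrow> fst u \<le> fst z"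
    using continuous_attains_inf[OF c ne cont] by blast
  obtain v where v: "v \<in> Q \<inter> {z. snd z = y}" "\<And>z. z \<in> Q \<inter> {z. snd z = y} \<Longrightarrow> fst z \<le> fst v"
    using continuous_attains_sup[OF c ne cont] by blast
  have "(fst u, y) \<in> Q" "(fst v, y) \<in> Q" using u(1) v(1) by (cases u; cases v; auto)+
  then show thesis
    by (rule that) (use u(2)[of "(_, y)"] v(2)[of "(_, y)"] in auto)
qed

text \<open>The hypothesis on edges says that each linear functional that attains its maximum over \<open>P\<close> at two
  different points attains its maximum over \<open>Q\<close> at two different lattice points.\<close>

lemma lattice_point_in_strip_coords:
  fixes P Q S :: "(real \<times> real) set"
  assumes L: "coord_lattice L D"
    and S: "finite S" "S \<subseteq> L" "P = convex hull S" and P: "(0, 0) \<in> P" "(1, 0) \<in> P"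
    and Q: "convex Q" "compact Q" "(0, 0) \<in> Q" "(0, 1) \<in> Q"
    and edges: "\<And>\<alpha> \<beta> k. \<lbrakk>\<exists>a\<in>P. \<exists>b\<in>P. a \<noteq> b \<and> \<alpha> * fst a + \<beta> * snd a = k \<and> \<alpha> * fst b + \<beta> * snd b = k;
        \<And>z. z \<in> P \<Longrightarrow> \<alpha> * fst z + \<beta> * snd z \<le> k\<rbrakk> \<Longrightarrow>
      \<exists>m. (\<exists>A\<in>L \<inter> Q. \<exists>B\<in>L \<inter> Q. A \<noteq> B \<and> \<alpha> * fst A + \<beta> * snd A = m \<and> \<alpha> * fst B + \<beta> * snd B = m) \<and>
        (\<forall>z\<in>Q. \<alpha> * fst z + \<beta> * snd z \<le> m)"
  shows "(\<exists>w\<in>L \<inter> P. 0 < fst w \<and> fst w < 1) \<or> (\<exists>w\<in>L \<inter> Q. 0 < snd w \<and> snd w < 1)"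
proof (rule ccontr)
  assume "\<not> ?thesis"
  then have freeP: "\<And>w. w \<in> L \<inter> P \<Longrightarrow> \<not> (0 < fst w \<and> fst w < 1)"
    and freeQ: "\<And>w. w \<in> L \<inter> Q \<Longrightarrow> \<not> (0 < snd w \<and> snd w < 1)" by auto
  have cP: "convex P" and SP: "S \<subseteq> P" using S(3) by (auto simp: hull_subset)
  have split: "fst s \<le> 0 \<or> 1 \<le> fst s" if "s \<in> S" for s
    using freeP[of s] that S SP by force
  obtain s0 where s0: "s0 \<in> S" "fst s0 \<le> 0"
  proof -
    have False if "\<And>s. s \<in> S \<Longrightarrow> 1 \<le> fst s"
      using hull_pair_bound[of S "-1" 0 "-1" "(0, 0)"] that P S by auto
    then show thesis using split that by blast
  qed
  obtain s1 where s1: "s1 \<in> S" "1 \<le> fst s1"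
  proof -
    have False if "\<And>s. s \<in> S \<Longrightarrow> fst s \<le> 0"
      using hull_pair_bound[of S 1 0 0 "(1, 0)"] that P S by auto
    then show thesis using split that by blast
  qed
  obtain l0 r0 where c0: "(l0, 0) \<in> Q" "(r0, 0) \<in> Q" "\<And>x. (x, 0) \<in> Q \<Longrightarrow> l0 \<le> x \<and> x \<le> r0"
    using horizontal_chord[OF Q(2,3)] by metis
  obtain l1 r1 where c1: "(l1, 1) \<in> Q" "(r1, 1) \<in> Q" "\<And>x. (x, 1) \<in> Q \<Longrightarrow> l1 \<le> x \<and> x \<le> r1"
    using horizontal_chord[OF Q(2,4)] by metis
  show False
  proof (cases "r1 - l1 \<le> r0 - l0")
    case True
    obtain t k a b where e: "a \<in> S" "fst a \<le> 0" "snd a - t * fst a = k"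
      "b \<in> S" "1 \<le> fst b" "snd b - t * fst b = k" "\<And>s. s \<in> S \<Longrightarrow> snd s - t * fst s \<le> k"
      using upper_crossing_edge[OF S(1) split s0 s1] by metis
    have maxP: "- t * fst z + 1 * snd z \<le> k" if "z \<in> P" for z
      by (rule hull_pair_bound[of S]) (use e(7) that S(3) in auto)
    have "a \<noteq> b" using e by force
    then have "\<exists>a\<in>P. \<exists>b\<in>P. a \<noteq> b \<and> - t * fst a + 1 * snd a = k \<and> - t * fst b + 1 * snd b = k"
      using e SP by (intro bexI[of _ a] bexI[of _ b]) auto
    from edges[OF this maxP] obtain m A B where AB: "A \<in> L \<inter> Q" "B \<in> L \<inter> Q" "A \<noteq> B"
      "- t * fst A + 1 * snd A = m" "- t * fst B + 1 * snd B = m"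
      and maxQ: "\<And>z. z \<in> Q \<Longrightarrow> - t * fst z + 1 * snd z \<le> m" by blast
    show False
      by (rule no_lattice_free_strips_upper_edge[OF L cP P Q(1,3,4) freeP freeQ,
          where ?l0.0 = l0 and ?r0.0 = r0 and ?l1.0 = l1 and ?r1.0 = r1 and t = t
            and k = k and m = m and A = A and B = B
            and a = a and b = b])
        (use e AB c0 c1 True S SP maxP maxQ in \<open>auto simp: algebra_simps\<close>)
  next
    case False
    have split': "fst s \<le> 0 \<or> 1 \<le> fst s" if "s \<in> (\<lambda>s. (fst s, - snd s)) ` S" for s
    proof -
      from that obtain s' where "s' \<in> S" "s = (fst s', - snd s')" by blast
      then show ?thesis using split[of s'] by simp
    qed
    obtain t k a b where e: "a \<in> (\<lambda>s. (fst s, - snd s)) ` S" "fst a \<le> 0" "snd a - t * fst a = k"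
      "b \<in> (\<lambda>s. (fst s, - snd s)) ` S" "1 \<le> fst b" "snd b - t * fst b = k"
      "\<And>s. s \<in> (\<lambda>s. (fst s, - snd s)) ` S \<Longrightarrow> snd s - t * fst s \<le> k"
      by (rule upper_crossing_edge[of "(\<lambda>s. (fst s, - snd s)) ` S" "(fst s0, - snd s0)" "(fst s1, - snd s1)"])
        (use S(1) split' s0 s1 in auto)
    obtain a' b' where ab: "a' \<in> S" "b' \<in> S" "a = (fst a', - snd a')" "b = (fst b', - snd b')"
      using e by blast
    have e7: "- t * fst s + - 1 * snd s \<le> k" if "s \<in> S" for s
      using e(7)[of "(fst s, - snd s)"] that by auto
    have maxP: "- t * fst z + - 1 * snd z \<le> k" if "z \<in> P" for z
      by (rule hull_pair_bound[of S]) (use e7 that S(3) in auto)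
    have "a' \<noteq> b'" using e ab by force
    then have "\<exists>a\<in>P. \<exists>b\<in>P. a \<noteq> b \<and> - t * fst a + - 1 * snd a = k \<and> - t * fst b + - 1 * snd b = k"
      using e ab SP by (intro bexI[of _ a'] bexI[of _ b']) auto
    from edges[OF this maxP] obtain m A B where AB: "A \<in> L \<inter> Q" "B \<in> L \<inter> Q" "A \<noteq> B"
      "- t * fst A + - 1 * snd A = m" "- t * fst B + - 1 * snd B = m"
      and maxQ: "\<And>z. z \<in> Q \<Longrightarrow> - t * fst z + - 1 * snd z \<le> m" by blast
    show False
      by (rule no_lattice_free_strips_lower_edge[OF L cP P Q(1,3,4) freeP freeQ,
          where ?l0.0 = l0 and ?r0.0 = r0 and ?l1.0 = l1 and ?r1.0 = r1 and t = t
            and k = k and m = m and A = A and B = B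
            and a = a' and b = b'])
        (use e ab AB c0 c1 False S SP maxP maxQ in \<open>auto simp: algebra_simps\<close>)
  qed
qed

section \<open>Lattice points in strips of lattice polygons\<close>

text \<open>The determinant of two vectors of the plane.\<close>

definition det2 :: "real ^ 2 \<Rightarrow> real ^ 2 \<Rightarrow> real" where
  "det2 u v = u $ 1 * v $ 2 - u $ 2 * v $ 1"

lemma det2_expand:
  assumes "det2 u v \<noteq> 0"
  shows "w = (det2 w v / det2 u v) *\<^sub>R u + (det2 u w / det2 u v) *\<^sub>R v"
proof -
  have "det2 u v *\<^sub>R w = det2 w v *\<^sub>R u + det2 u w *\<^sub>R v"
    by (simp add: vec_eq_iff forall_2 det2_def algebra_simps)
  then have "(1 / det2 u v) *\<^sub>R (det2 u v *\<^sub>R w) = (1 / det2 u v) *\<^sub>R (det2 w v *\<^sub>R u + det2 u w *\<^sub>R v)"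
    by simp
  then show ?thesis using assms by (simp add: scaleR_add_right)
qed

lemma det2_linear:
  "det2 (x + y) z = det2 x z + det2 y z" "det2 z (x + y) = det2 z x + det2 z y"
  "det2 (x - y) z = det2 x z - det2 y z" "det2 z (x - y) = det2 z x - det2 z y"
  "det2 (c *\<^sub>R x) z = c * det2 x z" "det2 z (c *\<^sub>R x) = c * det2 z x"
  "det2 (- x) z = - det2 x z" "det2 z (- x) = - det2 z x" "det2 x x = 0"
  by (simp_all add: det2_def algebra_simps)

lemma det2_commute: "det2 v u = - det2 u v"
  by (simp add: det2_def)

lemma det2_Ints: "u \<in> int_lattice \<Longrightarrow> v \<in> int_lattice \<Longrightarrow> det2 u v \<in> \<int>"
  by (simp add: det2_def int_lattice_def)

lemma int_lattice_add: "x \<in> int_lattice \<Longrightarrow> y \<in> int_lattice \<Longrightarrow> x + y \<in> int_lattice"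
  and int_lattice_diff: "x \<in> int_lattice \<Longrightarrow> y \<in> int_lattice \<Longrightarrow> x - y \<in> int_lattice"
  and int_lattice_scale: "x \<in> int_lattice \<Longrightarrow> of_int k *\<^sub>R x \<in> int_lattice"
  by (simp_all add: int_lattice_def)

lemma primitive_or_multiple:
  fixes u :: "real ^ 2"
  assumes "u \<in> int_lattice" "u \<noteq> 0"
  obtains (primitive) w where "w \<in> int_lattice" "det2 u w = 1"
  | (multiple) g u' where "u' \<in> int_lattice" "(2::int) \<le> g" "u = of_int g *\<^sub>R u'"
proof -
  obtain a b :: int where ab: "u $ 1 = of_int a" "u $ 2 = of_int b"
    using assms(1) unfolding int_lattice_def by (metis Ints_cases mem_Collect_eq)
  have "a \<noteq> 0 \<or> b \<noteq> 0" using assms(2) ab by (auto simp: vec_eq_iff forall_2)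
  then have g0: "0 < gcd a b" by simp
  show thesis
  proof (cases "gcd a b = 1")
    case True
    obtain x y where "x * a + y * b = gcd a b" using bezout_int by blast
    then have "of_int a * of_int x + of_int b * of_int y = (1::real)"
      using True by (metis of_int_1 of_int_add of_int_mult mult.commute)
    moreover have "vector [- of_int y, of_int x] \<in> (int_lattice :: (real ^ 2) set)"
      by (simp add: int_lattice_def forall_2)
    ultimately show thesis
      using ab by (intro primitive[of "vector [- of_int y, of_int x]"]) (auto simp: det2_def)
  next
    case False
    define g where "g = gcd a b"
    obtain a' b' where "a = g * a'" "b = g * b'" unfolding g_def by (metis dvdE gcd_dvd1 gcd_dvd2)
    then have "u = of_int g *\<^sub>R vector [of_int a', of_int b']"
      using ab by (simp add: vec_eq_iff forall_2)
    moreover have "vector [of_int a', of_int b'] \<in> (int_lattice :: (real ^ 2) set)"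
      by (simp add: int_lattice_def forall_2)
    moreover have "2 \<le> g" using False g0 unfolding g_def by linarith
    ultimately show thesis by (intro multiple)
  qed
qed

lemma convex_hull_affine_image:
  assumes "linear f"
  shows "(\<lambda>w. f (w - p)) ` (convex hull S) = convex hull ((\<lambda>w. f (w - p)) ` S)"
proof -
  have "(\<lambda>w. f (w - p)) ` X = f ` ((\<lambda>w. - p + w) ` X)" for X by (simp add: image_image)
  then show ?thesis
    by (simp only: convex_hull_translation[symmetric] convex_hull_linear_image[OF assms])
qed

text \<open>If \<open>u\<close> or \<open>v\<close> is a proper multiple of a lattice vector, then a lattice point inside the segment
  \<open>[p, p + u]\<close> or \<open>[q, q + v]\<close> does it. Otherwise the coordinates \<open>M\<close> with respect to \<open>u\<close> and \<open>v\<close> turn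
  the claim into \<open>lattice_point_in_strip_coords\<close>.\<close>

lemma lattice_point_in_strip:
  fixes S R P Q :: "(real ^ 2) set"
  assumes S: "finite S" "S \<subseteq> int_lattice" "P = convex hull S"
    and R: "finite R" "R \<subseteq> int_lattice" "Q = convex hull R"
    and edges: "\<And>n a b. \<lbrakk>a \<in> P; b \<in> P; a \<noteq> b; n \<bullet> b = n \<bullet> a; \<And>z. z \<in> P \<Longrightarrow> n \<bullet> z \<le> n \<bullet> a\<rbrakk> \<Longrightarrow>
      \<exists>A\<in>R. \<exists>B\<in>R. A \<noteq> B \<and> n \<bullet> B = n \<bullet> A \<and> (\<forall>z\<in>Q. n \<bullet> z \<le> n \<bullet> A)"
    and p: "p \<in> P \<inter> int_lattice" "p + u \<in> P \<inter> int_lattice"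
    and q: "q \<in> Q \<inter> int_lattice" "q + v \<in> Q \<inter> int_lattice"
    and big: "1 < \<bar>det2 u v\<bar>"
  shows "(\<exists>w\<in>P \<inter> int_lattice. 0 < det2 (w - p) v / det2 u v \<and> det2 (w - p) v / det2 u v < 1) \<or>
    (\<exists>w\<in>Q \<inter> int_lattice. 0 < det2 u (w - q) / det2 u v \<and> det2 u (w - q) / det2 u v < 1)"
proof -
  define d where "d = det2 u v"
  have d: "d \<noteq> 0" using big by (auto simp: d_def)
  have u: "u \<in> int_lattice" using int_lattice_diff[of "p + u" p] p by simp
  have v: "v \<in> int_lattice" using int_lattice_diff[of "q + v" q] q by simp
  have u0: "u \<noteq> 0" and v0: "v \<noteq> 0" using d by (auto simp: d_def det2_def)
  have cvx: "convex P" "convex Q" using S R by auto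
  have mid: "x + (1 / of_int g) *\<^sub>R y \<in> X" if "convex X" "x \<in> X" "x + y \<in> X" "2 \<le> g"
    for X and x y :: "real ^ 2" and g :: int
  proof -
    have "(1 - 1 / of_int g) *\<^sub>R x + (1 / of_int g) *\<^sub>R (x + y) \<in> X"
      using that by (intro convexD) auto
    then show ?thesis by (simp add: algebra_simps)
  qed
  show ?thesis
    using u u0
  proof (cases rule: primitive_or_multiple)
    case (multiple g u')
    have "p + u' \<in> P" using mid[OF cvx(1), of p u g] p multiple by simp
    moreover have "p + u' \<in> int_lattice" using int_lattice_add[of p u'] p multiple by simp
    moreover have "det2 u' v / d = 1 / of_int g" 
      using d multiple unfolding d_def by (auto simp: det2_linear divide_simps)
    ultimately show ?thesis using multiple(2) unfolding d_def
      by (intro disjI1 bexI[of _ "p + u'"]) auto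
  next
    case (primitive e)
    note e = this
    show ?thesis
      using v v0
    proof (cases rule: primitive_or_multiple)
      case (multiple g v')
      have "q + v' \<in> Q" using mid[OF cvx(2), of q v g] q multiple by simp
      moreover have "q + v' \<in> int_lattice" using int_lattice_add[of q v'] q multiple by simp
      moreover have "det2 u v' / d = 1 / of_int g"
        using d multiple unfolding d_def by (auto simp: det2_linear divide_simps)
      ultimately show ?thesis using multiple(2) unfolding d_def
        by (intro disjI2 bexI[of _ "q + v'"]) auto
    next
      case (primitive f)
      define D where "D = nat \<lfloor>\<bar>d\<bar>\<rfloor>"
      have "\<bar>d\<bar> \<in> \<int>" using det2_Ints[OF u v] by (simp add: d_def)
      then have D: "real D = \<bar>d\<bar>" by (simp add: D_def of_nat_nat of_int_floor)
      have sgn: "real D = d \<or> real D = - d" using D by linarith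
      define M where "M w = (det2 w v / d, det2 u w / d)" for w
      have lin: "linear M"
        by (rule linearI) (auto simp: M_def det2_linear add_divide_distrib)
      have inj: "x = y" if "M x = M y" for x y
      proof -
        have "det2 (x - y) v = 0" "det2 u (x - y) = 0" using that d by (auto simp: M_def det2_linear)
        then show ?thesis using det2_expand[of u v "x - y"] d by (simp add: d_def)
      qed
      have Mu: "M u = (1, 0)" and Mv: "M v = (0, 1)" using d by (auto simp: M_def d_def det2_linear)
      define L where "L = M ` int_lattice"
      define P' where "P' = (\<lambda>w. M (w - p)) ` P"
      define Q' where "Q' = (\<lambda>w. M (w - q)) ` Q"
      have P': "P' = convex hull ((\<lambda>w. M (w - p)) ` S)"
        unfolding P'_def S(3) by (rule convex_hull_affine_image[OF lin])
      have Q': "Q' = convex hull ((\<lambda>w. M (w - q)) ` R)"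
        unfolding Q'_def R(3) by (rule convex_hull_affine_image[OF lin])
      have "2 \<le> D" using big D by (simp add: d_def)
      moreover have "(1, 0) \<in> L" "(0, 1) \<in> L" using Mu Mv u v unfolding L_def by (metis image_eqI)+
      moreover have "r - s \<in> L" if "r \<in> L" "s \<in> L" for r s
        using that unfolding L_def
        by (auto simp: linear_diff[OF lin, symmetric] intro!: imageI int_lattice_diff)
      moreover have "real D * (fst r * snd s - snd r * fst s) \<in> \<int>" if rs: "r \<in> L" "s \<in> L" for r s
      proof -
        obtain r' s' where r': "r' \<in> int_lattice" "r = M r'" and s': "s' \<in> int_lattice" "s = M s'"
          using rs by (auto simp: L_def)
        have "det2 r' v * det2 u s' - det2 u r' * det2 s' v = d * det2 r' s'"
          by (simp add: d_def det2_def algebra_simps)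
        then have "fst r * snd s - snd r * fst s = d * det2 r' s' / (d * d)"
          by (simp add: r' s' M_def diff_divide_distrib[symmetric])
        then have "d * (fst r * snd s - snd r * fst s) = det2 r' s'" using d by simp
        then have "d * (fst r * snd s - snd r * fst s) \<in> \<int>" using det2_Ints[OF r'(1) s'(1)] by simp
        then have "- (d * (fst r * snd s - snd r * fst s)) \<in> \<int>" by (rule Ints_minus)
        with \<open>d * _ \<in> \<int>\<close> show ?thesis using sgn by fastforce
      qed
      moreover have "\<exists>x. (x, 1 / D) \<in> L"
      proof -
        have "M (of_int (if 0 < d then 1 else - 1) *\<^sub>R e) \<in> L"
          unfolding L_def using int_lattice_scale[OF e(1)] by blast
        moreover have "snd (M (of_int (if 0 < d then 1 else - 1) *\<^sub>R e)) = 1 / D"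
          using e(2) d D by (auto simp: M_def det2_linear)
        ultimately show ?thesis by (metis prod.collapse)
      qed
      moreover have "\<exists>y. (1 / D, y) \<in> L"
      proof -
        have "M (of_int (if 0 < d then - 1 else 1) *\<^sub>R f) \<in> L"
          unfolding L_def using int_lattice_scale[OF primitive(1)] by blast
        moreover have "fst (M (of_int (if 0 < d then - 1 else 1) *\<^sub>R f)) = 1 / D"
          using primitive(2) det2_commute[of v f] d D by (auto simp: M_def det2_linear)
        ultimately show ?thesis by (metis prod.collapse)
      qed
      ultimately have L: "coord_lattice L D" unfolding coord_lattice_def by blast
      have "(\<exists>w\<in>L \<inter> P'. 0 < fst w \<and> fst w < 1) \<or> (\<exists>w\<in>L \<inter> Q'. 0 < snd w \<and> snd w < 1)"
      proof (rule lattice_point_in_strip_coords[OF L _ _ P'])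
        show "finite ((\<lambda>w. M (w - p)) ` S)" using S by simp
        show "(\<lambda>w. M (w - p)) ` S \<subseteq> L" using S p int_lattice_diff by (auto simp: L_def)
        have M0: "M 0 = (0, 0)" using linear_0[OF lin] by (simp add: zero_prod_def)
        show "(0, 0) \<in> P'" unfolding P'_def by (rule image_eqI[of _ _ p]) (use p M0 in auto)
        show "(1, 0) \<in> P'" unfolding P'_def by (rule image_eqI[of _ _ "p + u"]) (use p Mu in auto)
        show "(0, 0) \<in> Q'" unfolding Q'_def by (rule image_eqI[of _ _ q]) (use q M0 in auto)
        show "(0, 1) \<in> Q'" unfolding Q'_def by (rule image_eqI[of _ _ "q + v"]) (use q Mv in auto)
        show "convex Q'" "compact Q'" unfolding Q' using R(1) by (auto intro: finite_imp_compact_convex_hull)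
      next
        fix \<alpha> \<beta> k :: real
        assume ab: "\<exists>a\<in>P'. \<exists>b\<in>P'. a \<noteq> b \<and> \<alpha> * fst a + \<beta> * snd a = k \<and> \<alpha> * fst b + \<beta> * snd b = k"
          and mx: "\<And>z. z \<in> P' \<Longrightarrow> \<alpha> * fst z + \<beta> * snd z \<le> k"
        \<comment> \<open>The functional \<open>(\<alpha>, \<beta>)\<close> in the original coordinates.\<close>
        define n :: "real ^ 2" where
          "n = vector [(\<alpha> * v $ 2 - \<beta> * u $ 2) / d, (\<beta> * u $ 1 - \<alpha> * v $ 1) / d]"
        have n: "\<alpha> * fst (M w) + \<beta> * snd (M w) = n \<bullet> w" for w
          using d by (simp add: n_def M_def inner_vec_def sum_2 det2_def field_simps)
        obtain a b where a: "a \<in> P" "n \<bullet> (a - p) = k" and b: "b \<in> P" "n \<bullet> (b - p) = k" and "a \<noteq> b"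
          using ab unfolding P'_def by (auto simp: n)
        have "n \<bullet> z \<le> n \<bullet> a" if "z \<in> P" for z
          using mx[of "M (z - p)"] that a by (auto simp: P'_def n inner_diff_right)
        moreover have "n \<bullet> b = n \<bullet> a" using a b by (simp add: inner_diff_right)
        ultimately obtain A B where AB: "A \<in> R" "B \<in> R" "A \<noteq> B" "n \<bullet> B = n \<bullet> A"
          and mxQ: "\<And>z. z \<in> Q \<Longrightarrow> n \<bullet> z \<le> n \<bullet> A"
          using edges[OF a(1) b(1) \<open>a \<noteq> b\<close>] by blast
        have in': "M (A - q) \<in> L \<inter> Q'" "M (B - q) \<in> L \<inter> Q'"
          using AB R q int_lattice_diff hull_subset[of R convex] by (auto simp: L_def Q'_def)
        have ne: "M (A - q) \<noteq> M (B - q)" using inj[of "A - q" "B - q"] AB by auto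
        show "\<exists>m. (\<exists>A\<in>L \<inter> Q'. \<exists>B\<in>L \<inter> Q'. A \<noteq> B \<and> \<alpha> * fst A + \<beta> * snd A = m \<and> \<alpha> * fst B + \<beta> * snd B = m) \<and>
            (\<forall>z\<in>Q'. \<alpha> * fst z + \<beta> * snd z \<le> m)"
        proof (intro exI[of _ "n \<bullet> (A - q)"] conjI ballI)
          show "\<exists>x\<in>L \<inter> Q'. \<exists>y\<in>L \<inter> Q'. x \<noteq> y \<and> \<alpha> * fst x + \<beta> * snd x = n \<bullet> (A - q) \<and>
              \<alpha> * fst y + \<beta> * snd y = n \<bullet> (A - q)"
            by (rule bexI[OF _ in'(1)], rule bexI[OF _ in'(2)])
              (use ne AB in \<open>auto simp: n inner_diff_right\<close>)
          show "\<alpha> * fst z + \<beta> * snd z \<le> n \<bullet> (A - q)" if "z \<in> Q'" for z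
            using that mxQ by (auto simp: Q'_def n inner_diff_right)
        qed
      qed
      moreover have lat: "z \<in> int_lattice" if zx: "M (z - x) \<in> L" "x \<in> int_lattice" for z x
      proof -
        obtain y where y: "y \<in> int_lattice" "M (z - x) = M y" using zx(1) unfolding L_def by blast
        then have "z = y + x" using inj[of "z - x" y] by (simp add: algebra_simps)
        then show ?thesis using int_lattice_add[OF y(1) zx(2)] by simp
      qed
      ultimately consider w where "w \<in> P" "M (w - p) \<in> L" "0 < fst (M (w - p))" "fst (M (w - p)) < 1"
        | w where "w \<in> Q" "M (w - q) \<in> L" "0 < snd (M (w - q))" "snd (M (w - q)) < 1"
        unfolding P'_def Q'_def by blast
      then show ?thesis
      proof cases
        case (1 w)
        then have "w \<in> P \<inter> int_lattice" using lat p(1) by blast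
        then show ?thesis using 1(3,4) unfolding M_def d_def fst_conv by blast
      next
        case (2 w)
        then have "w \<in> Q \<inter> int_lattice" using lat q(1) by blast
        then show ?thesis using 2(3,4) unfolding M_def d_def snd_conv by blast
      qed
    qed
  qed
qed

section \<open>Edges of polytopes with refining normal fans\<close>

text \<open>If \<open>n\<close> attained its maximum over \<open>Q\<close> at a single vertex \<open>A\<close>, the normal cone of \<open>A\<close> would contain a
  neighbourhood of \<open>n\<close>, but no normal cone of \<open>P\<close> does, as \<open>n\<close> is maximal at both \<open>a\<close> and \<open>b\<close>.\<close>

lemma parallel_edge_of_refining_fan:
  fixes P Q :: "'a::euclidean_space set"
  assumes R: "finite R" "Q = convex hull R" "R \<noteq> {}"
    and fan: "weak_Minkowski_summand P Q"
    and ab: "a \<in> P" "b \<in> P" "a \<noteq> b" "n \<bullet> b = n \<bullet> a" and mx: "\<And>z. z \<in> P \<Longrightarrow> n \<bullet> z \<le> n \<bullet> a"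
  shows "\<exists>A\<in>R. \<exists>B\<in>R. A \<noteq> B \<and> n \<bullet> B = n \<bullet> A \<and> (\<forall>z\<in>Q. n \<bullet> z \<le> n \<bullet> A)"
proof (rule ccontr)
  assume no: "\<not> ?thesis"
  have "Max ((\<bullet>) n ` R) \<in> (\<bullet>) n ` R" using R by (intro Max_in) auto
  then obtain A where A: "A \<in> R" "n \<bullet> A = Max ((\<bullet>) n ` R)" by auto
  then have AR: "n \<bullet> z \<le> n \<bullet> A" if "z \<in> R" for z using that R(1) by auto
  have hull: "z \<in> {z. m \<bullet> z \<le> m \<bullet> A}" if "\<And>z. z \<in> R \<Longrightarrow> m \<bullet> z \<le> m \<bullet> A" "z \<in> Q" for m z
  proof -
    have "convex hull R \<subseteq> {z. m \<bullet> z \<le> m \<bullet> A}"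
      by (intro hull_minimal convex_halfspace_le) (use that in auto)
    then show ?thesis using that R by blast
  qed
  have AQ: "n \<bullet> z \<le> n \<bullet> A" if "z \<in> Q" for z using hull[OF AR that] by simp
  have less: "n \<bullet> z < n \<bullet> A" if "z \<in> R" "z \<noteq> A" for z
    using no A AQ AR[OF that(1)] that by (metis order_less_le)
  define F where "F = Q \<inter> {z. n \<bullet> z = n \<bullet> A}"
  have F: "F face_of Q" unfolding F_def
    by (rule face_of_Int_supporting_hyperplane_le) (use R AQ in auto)
  have "F = {A}"
  proof -
    obtain R' where R': "R' \<subseteq> R" "F = convex hull R'"
      using face_of_convex_hull_subset[of R F] F R finite_imp_compact by blast
    then have "R' \<subseteq> {A}" using less hull_subset[of R' convex] by (force simp: F_def)
    moreover have "A \<in> F" using A R hull_inc[of A R convex] by (auto simp: F_def)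
    ultimately show ?thesis using R' by (metis convex_hull_eq_empty convex_hull_singleton empty_iff subset_singletonD)
  qed
  then have "normal_cone Q {A} \<in> normal_fan Q" using F by (auto simp: normal_fan_def)
  then obtain C where "C \<in> normal_fan P" "normal_cone Q {A} \<subseteq> C"
    using fan unfolding weak_Minkowski_summand_def fan_refines_def by blast
  then obtain G where G: "G face_of P" "G \<noteq> {}" "normal_cone Q {A} \<subseteq> normal_cone P G"
    unfolding normal_fan_def by blast
  obtain y where y: "y \<in> G" using G by auto
  then have yP: "y \<in> P" using G face_of_imp_subset by blast
  have cone: "m \<bullet> z \<le> m \<bullet> y" if "\<And>x. x \<in> R \<Longrightarrow> m \<bullet> x \<le> m \<bullet> A" "z \<in> P" for m z
    using hull[OF that(1)] that(2) G(3) y unfolding normal_cone_def by blast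
  define t where "t = a - b"
  \<comment> \<open>\<open>K\<close> is so large that \<open>K n + t\<close> and \<open>K n - t\<close> lie in the normal cone of \<open>A\<close>.\<close>
  define K where "K = (\<Sum>x\<in>R - {A}. \<bar>t \<bullet> (x - A)\<bar> / (n \<bullet> A - n \<bullet> x))"
  have K: "\<bar>t \<bullet> (x - A)\<bar> \<le> K * (n \<bullet> A - n \<bullet> x)" if "x \<in> R" for x
  proof (cases "x = A")
    case False
    have "\<bar>t \<bullet> (x - A)\<bar> / (n \<bullet> A - n \<bullet> x) \<le> K" unfolding K_def
      using False that R(1) less by (intro member_le_sum) (auto intro!: divide_nonneg_nonneg simp: order_less_imp_le)
    then show ?thesis using less[OF that False] by (simp add: divide_le_eq)
  qed simp
  have 1: "(K *\<^sub>R n + t) \<bullet> x \<le> (K *\<^sub>R n + t) \<bullet> A" if "x \<in> R" for x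
    using K[OF that] by (simp add: inner_add_left inner_diff_right algebra_simps)
  have 2: "(K *\<^sub>R n - t) \<bullet> x \<le> (K *\<^sub>R n - t) \<bullet> A" if "x \<in> R" for x
    using K[OF that] by (simp add: inner_diff_left inner_diff_right algebra_simps)
  have ny: "n \<bullet> y = n \<bullet> a" using cone[OF AR ab(1)] mx[OF yP] by simp
  have "t \<bullet> z = t \<bullet> y" if "z \<in> P" "n \<bullet> z = n \<bullet> a" for z
    using cone[OF 1 that(1)] cone[OF 2 that(1)] ny that(2) by (simp add: inner_add_left inner_diff_left)
  then have "t \<bullet> a = t \<bullet> b" using ab by metis
  then have "t \<bullet> t = 0" by (simp add: t_def inner_diff_right)
  then show False using ab(3) by (simp add: t_def)
qed

section \<open>Exchanging a vertex of a tetrahedron\<close>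

text \<open>Writing \<open>x = t w + (x - t w)\<close> with \<open>t\<close> as large as nonnegativity of the coefficients of \<open>x - t w\<close>
  allows, the coefficient of one \<open>a i\<close> with \<open>c i > 0\<close> vanishes.\<close>

lemma convex_hull_exchange_point:
  fixes a :: "'i \<Rightarrow> 'a::real_vector"
  assumes I: "finite I" and x: "x = (\<Sum>i\<in>I. l i *\<^sub>R a i)" "\<And>i. i \<in> I \<Longrightarrow> 0 \<le> l i" "sum l I = 1"
    and w: "w = (\<Sum>i\<in>I. c i *\<^sub>R a i)" "sum c I = (1::real)"
  obtains i where "i \<in> I" "0 < c i" "x \<in> convex hull (insert w (a ` (I - {i})))"
proof -
  define J where "J = {i\<in>I. 0 < c i}"
  have "J \<noteq> {}"
  proof
    assume "J = {}"
    then have "sum c I \<le> 0" by (intro sum_nonpos) (force simp: J_def)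
    then show False using w(2) by simp
  qed
  moreover have "finite J" using I by (simp add: J_def)
  ultimately obtain i where i: "i \<in> J" "\<And>j. j \<in> J \<Longrightarrow> l i / c i \<le> l j / c j"
    using ex_is_arg_min_if_finite[of J "\<lambda>j. l j / c j"] unfolding is_arg_min_linorder by blast
  define t where "t = l i / c i"
  have iI: "i \<in> I" and ci: "0 < c i" using i(1) by (auto simp: J_def)
  have t0: "0 \<le> t" using x(2)[OF iI] ci by (simp add: t_def)
  have nonneg: "0 \<le> l j - t * c j" if "j \<in> I" for j
  proof (cases "0 < c j")
    case True
    then show ?thesis using i(2)[of j] that by (simp add: J_def t_def pos_le_divide_eq)
  next
    case False
    then have "t * c j \<le> 0" using t0 by (simp add: mult_nonneg_nonpos)
    then show ?thesis using x(2)[OF that] by linarith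
  qed
  have zero: "l i - t * c i = 0" using ci by (simp add: t_def)
  define m where "m j = (if j = i then t else l j - t * c j)" for j
  define y where "y j = (if j = i then w else a j)" for j
  have "(\<Sum>j\<in>I. m j) = t + (\<Sum>j\<in>I - {i}. l j - t * c j)"
    using I iI by (simp add: sum.remove[of I i] m_def)
  also have "\<dots> = t + (\<Sum>j\<in>I. l j - t * c j)"
    using I iI zero by (simp add: sum.remove[of I i "\<lambda>j. l j - t * c j"])
  also have "\<dots> = 1" using x(3) w(2) by (simp add: sum_subtractf sum_distrib_left[symmetric])
  finally have m1: "sum m I = 1" .
  have "(\<Sum>j\<in>I. m j *\<^sub>R y j) = t *\<^sub>R w + (\<Sum>j\<in>I - {i}. (l j - t * c j) *\<^sub>R a j)"
    using I iI by (simp add: sum.remove[of I i] m_def y_def)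
  also have "\<dots> = t *\<^sub>R w + (\<Sum>j\<in>I. (l j - t * c j) *\<^sub>R a j)"
    using I iI zero by (simp add: sum.remove[of I i "\<lambda>j. (l j - t * c j) *\<^sub>R a j"])
  also have "\<dots> = x"
    by (simp add: x(1) w(1) scaleR_diff_left sum_subtractf scaleR_sum_right)
  finally have "x = (\<Sum>j\<in>I. m j *\<^sub>R y j)" ..
  moreover have "(\<Sum>j\<in>I. m j *\<^sub>R y j) \<in> convex hull (insert w (a ` (I - {i})))"
  proof (rule convex_sum[OF I _ m1])
    show "0 \<le> m j" if "j \<in> I" for j using nonneg[OF that] t0 by (simp add: m_def)
    show "y j \<in> convex hull (insert w (a ` (I - {i})))" if "j \<in> I" for j
      using that by (intro hull_inc) (auto simp: y_def)
  qed simp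
  ultimately show thesis using that[OF iI ci] by simp
qed

lemma tetrahedron_exchange:
  fixes a b c d :: "'a::real_vector"
  assumes "x \<in> convex hull {a, b, c, d}"
    and "w = \<alpha> *\<^sub>R a + \<beta> *\<^sub>R b + \<gamma> *\<^sub>R c + \<delta> *\<^sub>R d" "\<alpha> + \<beta> + \<gamma> + \<delta> = (1::real)"
  obtains "0 < \<alpha>" "x \<in> convex hull {w, b, c, d}"
  | "0 < \<beta>" "x \<in> convex hull {a, w, c, d}"
  | "0 < \<gamma>" "x \<in> convex hull {a, b, w, d}"
  | "0 < \<delta>" "x \<in> convex hull {a, b, c, w}"
proof -
  obtain u v y where uv: "0 \<le> u" "0 \<le> v" "u + v = 1" "y \<in> convex hull {b, c, d}" "x = u *\<^sub>R a + v *\<^sub>R y"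
    using assms(1) unfolding convex_hull_insert[OF insert_not_empty, of a b "{c, d}"] by blast
  obtain r s t where rst: "0 \<le> r" "0 \<le> s" "0 \<le> t" "r + s + t = 1" "y = r *\<^sub>R b + s *\<^sub>R c + t *\<^sub>R d"
    using uv(4) unfolding convex_hull_3 by blast
  define f where "f = (\<lambda>i::nat. if i = 0 then a else if i = 1 then b else if i = 2 then c else d)"
  define l where "l = (\<lambda>i::nat. if i = 0 then u else if i = 1 then v * r else if i = 2 then v * s else v * t)"
  define k where "k = (\<lambda>i::nat. if i = 0 then \<alpha> else if i = 1 then \<beta> else if i = 2 then \<gamma> else \<delta>)"
  have sums: "v * r + (v * s + v * t) = v" using rst(4) by (metis add.assoc distrib_left mult.right_neutral)
  obtain i where i: "i \<in> {0, 1, 2, 3}" "0 < k i" "x \<in> convex hull (insert w (f ` ({0, 1, 2, 3} - {i})))"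
  proof (rule convex_hull_exchange_point[of "{0, 1, 2, 3}" x l f w k])
    show "x = (\<Sum>i\<in>{0, 1, 2, 3}. l i *\<^sub>R f i)"
      by (simp add: l_def f_def uv(5) rst(5) scaleR_add_right)
    show "0 \<le> l i" if "i \<in> {0, 1, 2, 3}" for i using uv rst by (simp add: l_def)
    show "sum l {0, 1, 2, 3} = 1" using uv(3) sums by (simp add: l_def)
    show "w = (\<Sum>i\<in>{0, 1, 2, 3}. k i *\<^sub>R f i)" by (simp add: assms(2) k_def f_def)
    show "sum k {0, 1, 2, 3} = 1" using assms(3) by (simp add: k_def)
  qed auto
  then consider "i = 0" | "i = 1" | "i = 2" | "i = 3" by blast
  then show thesis
  proof cases
    case 1
    moreover have "f ` ({0, 1, 2, 3} - {0}) = {b, c, d}" by (simp add: insert_Diff_if f_def insert_commute)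
    ultimately show thesis using i that(1) by (simp add: k_def)
  next
    case 2
    moreover have "f ` ({0, 1, 2, 3} - {1}) = {a, c, d}" by (simp add: insert_Diff_if f_def insert_commute)
    moreover have "{a, w, c, d} = insert w {a, c, d}" by blast
    ultimately show thesis using i that(2) by (simp add: k_def)
  next
    case 3
    moreover have "f ` ({0, 1, 2, 3} - {2}) = {a, b, d}" by (simp add: insert_Diff_if f_def insert_commute)
    moreover have "{a, b, w, d} = insert w {a, b, d}" by blast
    ultimately show thesis using i that(3) by (simp add: k_def)
  next
    case 4
    moreover have "f ` ({0, 1, 2, 3} - {3}) = {a, b, c}" by (simp add: insert_Diff_if f_def insert_commute)
    moreover have "{a, b, c, w} = insert w {a, b, c}" by blast
    ultimately show thesis using i that(4) by (simp add: k_def)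
  qed
qed

section \<open>Unimodular tetrahedra\<close>

lemma det_Ints:
  fixes A :: "real ^ 'n ^ 'n"
  assumes "\<And>i j. A $ i $ j \<in> \<int>"
  shows "det A \<in> \<int>"
  unfolding det_def by (intro Ints_sum Ints_mult Ints_prod assms Ints_of_int)

text \<open>By Cramer's rule the coefficients with respect to \<open>b\<close> are quotients of integers by \<open>\<plusminus>1\<close>.\<close>

lemma lattice_basis_of_det:
  fixes b :: "'n \<Rightarrow> real ^ 'n"
  assumes b: "range b \<subseteq> int_lattice" and det: "\<bar>det (\<chi> i. b i)\<bar> = 1"
  shows "lattice_basis b"
  unfolding lattice_basis_def
proof (intro conjI ballI b)
  fix z :: "real ^ 'n" assume z: "z \<in> int_lattice"
  define A where "A = transpose (\<chi> i. b i)"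
  have dA: "\<bar>det A\<bar> = 1" using det by (simp add: A_def det_transpose)
  have Aint: "A $ i $ j \<in> \<int>" for i j
    using b by (auto simp: A_def transpose_def int_lattice_def)
  have sys: "z = (\<Sum>i\<in>UNIV. of_int (c i) *\<^sub>R b i) \<longleftrightarrow> A *v (\<chi> i. of_int (c i)) = z" for c :: "'n \<Rightarrow> int"
    by (auto simp: vec_eq_iff matrix_vector_mult_def A_def transpose_def mult.commute)
  define y where "y = (\<chi> k. det (\<chi> i j. if j = k then z $ i else A $ i $ j) / det A)"
  have y: "A *v x = z \<longleftrightarrow> x = y" for x
    unfolding y_def using dA by (intro cramer) auto
  have "y $ k \<in> \<int>" for k
  proof -
    have "det (\<chi> i j. if j = k then z $ i else A $ i $ j) \<in> \<int>"
      using z Aint by (intro det_Ints) (auto simp: int_lattice_def)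
    moreover have "det A = 1 \<or> det A = -1" using dA by linarith
    ultimately show ?thesis by (auto simp: y_def)
  qed
  then have fl: "of_int \<lfloor>y $ k\<rfloor> = y $ k" for k by (simp add: of_int_floor)
  show "\<exists>!c. z = (\<Sum>i\<in>UNIV. of_int (c i) *\<^sub>R b i)"
  proof (rule ex1I[of _ "\<lambda>k. \<lfloor>y $ k\<rfloor>"])
    show "z = (\<Sum>i\<in>UNIV. of_int \<lfloor>y $ i\<rfloor> *\<^sub>R b i)"
      unfolding sys[of "\<lambda>k. \<lfloor>y $ k\<rfloor>"] y by (simp add: vec_eq_iff fl)
    show "c = (\<lambda>k. \<lfloor>y $ k\<rfloor>)" if "z = (\<Sum>i\<in>UNIV. of_int (c i) *\<^sub>R b i)" for c
    proof
      fix k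
      have "(\<chi> i. of_int (c i)) = y" using that unfolding sys y .
      then have "y $ k = of_int (c k)" by (metis vec_lambda_beta)
      then show "c k = \<lfloor>y $ k\<rfloor>" by simp
    qed
  qed
qed

lemma unimodular_tetrahedron_hull:
  assumes lat: "a \<in> int_lattice" "b \<in> int_lattice" "c \<in> int_lattice" "d \<in> int_lattice"
    and det: "\<bar>det (vector [b - a, c - a, d - a] :: real ^ 3 ^ 3)\<bar> = 1"
  shows "unimodular_tetrahedron (convex hull {a, b, c, d})"
proof -
  define e where "e i = (vector [b - a, c - a, d - a] :: real ^ 3 ^ 3) $ i" for i
  have e: "e 1 = b - a" "e 2 = c - a" "e 3 = d - a" by (simp_all add: e_def)
  have U: "UNIV = {1, 2, 3 :: 3}" by (rule UNIV_3)
  have "range e \<subseteq> int_lattice" using lat by (auto simp: U e intro: int_lattice_diff)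
  moreover have "(\<chi> i. e i) = vector [b - a, c - a, d - a]" by (simp add: e_def vec_eq_iff)
  ultimately have "lattice_basis e" using det lattice_basis_of_det by metis
  moreover have "range (\<lambda>i. a + e i) = {b, c, d}" by (auto simp: U e)
  ultimately show ?thesis
    unfolding unimodular_tetrahedron_def using lat(1) by metis
qed

text \<open>A set all of whose points are covered in this sense has a unimodular cover, namely the set of all
  unimodular tetrahedra that it contains.\<close>

definition covered :: "(real ^ 3) set \<Rightarrow> real ^ 3 \<Rightarrow> bool" where
  "covered C x \<longleftrightarrow> (\<exists>T. unimodular_tetrahedron T \<and> T \<subseteq> C \<and> x \<in> T)"

lemma at_height_in_lattice: "h \<in> \<int> \<Longrightarrow> x \<in> int_lattice \<Longrightarrow> at_height h x \<in> int_lattice"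
  by (simp add: int_lattice_def at_height_def forall_3)

lemma det_apex_triangle:
  "det (vector [at_height h b - at_height h a, at_height h c - at_height h a, at_height h' d - at_height h a] :: real ^ 3 ^ 3)
     = (h' - h) * det2 (b - a) (c - a)"
  by (simp add: det_3 at_height_def det2_def algebra_simps)

lemma det_opposite_edges:
  "det (vector [at_height 0 p' - at_height 0 p, at_height 1 q - at_height 0 p, at_height 1 q' - at_height 0 p] :: real ^ 3 ^ 3)
     = - det2 (p' - p) (q' - q)"
  by (simp add: det_3 at_height_def det2_def algebra_simps)

lemma Ints_abs_cases:
  assumes "(r::real) \<in> \<int>" "r \<noteq> 0"
  obtains "\<bar>r\<bar> = 1" | "1 < \<bar>r\<bar>"
proof -
  have "1 \<le> \<bar>r\<bar>" using assms by (rule Ints_nonzero_abs_ge1)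
  then show thesis using that by linarith
qed

lemma Ints_nat_floor_less:
  assumes "(x::real) \<in> \<int>" "y \<in> \<int>" "\<bar>x\<bar> < \<bar>y\<bar>"
  shows "nat \<lfloor>\<bar>x\<bar>\<rfloor> < nat \<lfloor>\<bar>y\<bar>\<rfloor>"
proof -
  have "\<bar>x\<bar> \<in> \<int>" "\<bar>y\<bar> \<in> \<int>" using assms by auto
  then have "of_int \<lfloor>\<bar>x\<bar>\<rfloor> = \<bar>x\<bar>" "of_int \<lfloor>\<bar>y\<bar>\<rfloor> = \<bar>y\<bar>" by (simp_all add: of_int_floor)
  then show ?thesis using assms(3) by linarith
qed

text \<open>A lattice triangle that is not unimodular contains a lattice point that is not a vertex: if \<open>u\<close> and
  \<open>v\<close> do not generate the lattice, the half-open parallelogram spanned by them contains a nonzero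
  lattice point, and reflection in the centre of the parallelogram moves it into the triangle if
  necessary.\<close>

lemma lattice_point_not_vertex:
  assumes lat: "a \<in> int_lattice" "a + u \<in> int_lattice" "a + v \<in> int_lattice" and big: "1 < \<bar>det2 u v\<bar>"
  obtains x y where "0 \<le> x" "x < 1" "0 \<le> y" "y < 1" "0 < x + y" "x + y \<le> 1"
    "a + x *\<^sub>R u + y *\<^sub>R v \<in> int_lattice"
proof -
  define d where "d = det2 u v"
  have u: "u \<in> int_lattice" using int_lattice_diff[OF lat(2,1)] by simp
  have v: "v \<in> int_lattice" using int_lattice_diff[OF lat(3,1)] by simp
  have d: "1 < \<bar>d\<bar>" using big by (simp add: d_def)
  have "\<exists>e\<in>int_lattice. det2 e v / d \<notin> \<int> \<or> det2 u e / d \<notin> \<int>"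
  proof (rule ccontr)
    assume "\<not> ?thesis"
    then have all: "det2 e v / d \<in> \<int>" "det2 u e / d \<in> \<int>" if "e \<in> int_lattice" for e
      using that by blast+
    have e: "vector [1, 0] \<in> (int_lattice :: (real ^ 2) set)" "vector [0, 1] \<in> (int_lattice :: (real ^ 2) set)"
      by (simp_all add: int_lattice_def forall_2)
    have "v $ 2 / d \<in> \<int>" "- v $ 1 / d \<in> \<int>" "- u $ 2 / d \<in> \<int>" "u $ 1 / d \<in> \<int>"
      using all[OF e(1)] all[OF e(2)] by (simp_all add: det2_def)
    then have "(u $ 1 / d) * (v $ 2 / d) - (- u $ 2 / d) * (- v $ 1 / d) \<in> \<int>"
      by (intro Ints_diff Ints_mult)
    moreover have "(u $ 1 / d) * (v $ 2 / d) - (- u $ 2 / d) * (- v $ 1 / d) = d / (d * d)"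
      by (simp add: d_def det2_def diff_divide_distrib)
    ultimately have "1 / d \<in> \<int>" using d by simp
    then have "1 \<le> \<bar>1 / d\<bar>" using d by (intro Ints_nonzero_abs_ge1) auto
    then show False using d by (simp add: divide_simps split: if_splits)
  qed
  then obtain e where e: "e \<in> int_lattice" "det2 e v / d \<notin> \<int> \<or> det2 u e / d \<notin> \<int>" by blast
  define x y where "x = frac (det2 e v / d)" and "y = frac (det2 u e / d)"
  have xy: "0 \<le> x" "x < 1" "0 \<le> y" "y < 1" "0 < x \<or> 0 < y"
    using e(2) by (auto simp: x_def y_def frac_lt_1 frac_gt_0_iff)
  have "e = (det2 e v / d) *\<^sub>R u + (det2 u e / d) *\<^sub>R v"
    unfolding d_def by (rule det2_expand) (use d in \<open>auto simp: d_def\<close>)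
  then have "x *\<^sub>R u + y *\<^sub>R v = e - of_int \<lfloor>det2 e v / d\<rfloor> *\<^sub>R u - of_int \<lfloor>det2 u e / d\<rfloor> *\<^sub>R v"
    by (simp add: x_def y_def frac_def scaleR_diff_left algebra_simps)
  then have r: "x *\<^sub>R u + y *\<^sub>R v \<in> int_lattice"
    using e(1) u v by (simp add: int_lattice_diff int_lattice_scale)
  show thesis
  proof (cases "x + y \<le> 1")
    case True
    show thesis
      by (rule that[of x y]) (use xy True int_lattice_add[OF lat(1) r] in \<open>auto simp: algebra_simps\<close>)
  next
    case False
    have "(a + u) + (v - (x *\<^sub>R u + y *\<^sub>R v)) \<in> int_lattice"
      by (rule int_lattice_add[OF lat(2) int_lattice_diff[OF v r]])
    then have "a + (1 - x) *\<^sub>R u + (1 - y) *\<^sub>R v \<in> int_lattice" by (simp add: algebra_simps)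
    then show thesis using xy False by (intro that[of "1 - x" "1 - y"]) auto
  qed
qed

lemma at_height_affine:
  "\<alpha> + \<beta> + \<gamma> = 1 \<Longrightarrow>
    at_height h (\<alpha> *\<^sub>R a + \<beta> *\<^sub>R b + \<gamma> *\<^sub>R c) = \<alpha> *\<^sub>R at_height h a + \<beta> *\<^sub>R at_height h b + \<gamma> *\<^sub>R at_height h c"
  by (simp add: at_height_def vec_eq_iff forall_3 distrib_right[symmetric])

text \<open>Tetrahedra with a horizontal facet, by induction on the area of that facet.\<close>

lemma covered_apex_triangle:
  assumes C: "convex C" and X: "convex X" "at_height h ` X \<subseteq> C"
    and h: "h \<in> \<int>" "h' \<in> \<int>" "\<bar>h' - h\<bar> = 1"
    and d: "d \<in> int_lattice" "at_height h' d \<in> C"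
    and abc: "a \<in> X \<inter> int_lattice" "b \<in> X \<inter> int_lattice" "c \<in> X \<inter> int_lattice"
    and nz: "det2 (b - a) (c - a) \<noteq> 0"
    and x: "x \<in> convex hull {at_height h a, at_height h b, at_height h c, at_height h' d}"
  shows "covered C x"
  using abc nz x
proof (induction "nat \<lfloor>\<bar>det2 (b - a) (c - a)\<bar>\<rfloor>" arbitrary: a b c rule: less_induct)
  case (less a b c)
  note abc = less.prems(1-3)
  have int: "det2 (b - a) (c - a) \<in> \<int>" using abc by (intro det2_Ints int_lattice_diff) auto
  show ?case
    using int less.prems(4)
  proof (cases rule: Ints_abs_cases)
    case 1
    have "unimodular_tetrahedron (convex hull {at_height h a, at_height h b, at_height h c, at_height h' d})"
    proof (rule unimodular_tetrahedron_hull)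
      show "\<bar>det (vector [at_height h b - at_height h a, at_height h c - at_height h a,
          at_height h' d - at_height h a] :: real ^ 3 ^ 3)\<bar> = 1"
        unfolding det_apex_triangle abs_mult using 1 h(3) by simp
    qed (use abc d h in \<open>auto intro: at_height_in_lattice\<close>)
    moreover have "convex hull {at_height h a, at_height h b, at_height h c, at_height h' d} \<subseteq> C"
      using abc d X C by (intro hull_minimal) auto
    ultimately show ?thesis unfolding covered_def using less.prems(5) by blast
  next
    case 2
    define u v where "u = b - a" and "v = c - a"
    have "a + u \<in> int_lattice" "a + v \<in> int_lattice" using abc by (auto simp: u_def v_def)
    then obtain r s where rs: "0 \<le> r" "r < 1" "0 \<le> s" "s < 1" "0 < r + s" "r + s \<le> 1"
      and lat: "a + r *\<^sub>R u + s *\<^sub>R v \<in> int_lattice"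
      using lattice_point_not_vertex[of a u v] abc 2 unfolding u_def v_def by blast
    define t where "t = 1 - r - s"
    define w where "w = a + r *\<^sub>R u + s *\<^sub>R v"
    have w: "w = t *\<^sub>R a + r *\<^sub>R b + s *\<^sub>R c" by (simp add: w_def u_def v_def t_def algebra_simps)
    have t: "0 \<le> t" "t < 1" "t + r + s = 1" using rs by (auto simp: t_def)
    then have t': "t + r + s + 0 = 1" by simp
    have "w \<in> convex hull {a, b, c}" unfolding convex_hull_3 using w t rs by blast
    moreover have "convex hull {a, b, c} \<subseteq> X" using abc X(1) by (intro hull_minimal) auto
    ultimately have wX: "w \<in> X \<inter> int_lattice" using lat by (auto simp: w_def)
    have wh: "at_height h w = t *\<^sub>R at_height h a + r *\<^sub>R at_height h b + s *\<^sub>R at_height h c + 0 *\<^sub>R at_height h' d"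
      unfolding w using at_height_affine[OF t(3)] by simp
    have step: "covered C x" if "0 < k" "k < 1" "a' \<in> X \<inter> int_lattice" "b' \<in> X \<inter> int_lattice" "c' \<in> X \<inter> int_lattice"
      "det2 (b' - a') (c' - a') = k * det2 (b - a) (c - a)"
      "x \<in> convex hull {at_height h a', at_height h b', at_height h c', at_height h' d}" for k a' b' c'
    proof (rule less.hyps[OF _ that(3-5)])
      show "det2 (b' - a') (c' - a') \<noteq> 0" using that(1,6) less.prems(4) by simp
      have "\<bar>det2 (b' - a') (c' - a')\<bar> < \<bar>det2 (b - a) (c - a)\<bar>"
        using mult_strict_right_mono[OF that(2), of "\<bar>det2 (b - a) (c - a)\<bar>"] that(1,6) less.prems(4)
        by (simp add: abs_mult)
      moreover have "det2 (b' - a') (c' - a') \<in> \<int>" using that by (intro det2_Ints int_lattice_diff) auto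
      ultimately show "nat \<lfloor>\<bar>det2 (b' - a') (c' - a')\<bar>\<rfloor> < nat \<lfloor>\<bar>det2 (b - a) (c - a)\<bar>\<rfloor>"
        using int Ints_nat_floor_less by blast
    qed (use that in auto)
    have wa: "w - a = r *\<^sub>R u + s *\<^sub>R v" "b - w = (1 - r) *\<^sub>R u - s *\<^sub>R v" "c - w = (1 - s) *\<^sub>R v - r *\<^sub>R u"
      by (simp_all add: w_def u_def v_def algebra_simps)
    have vu: "det2 v u = - det2 u v" by (rule det2_commute)
    have "det2 (b - w) (c - w) = t * det2 u v" "det2 (w - a) v = r * det2 u v" "det2 u (w - a) = s * det2 u v"
      by (simp_all add: wa det2_linear vu t_def algebra_simps)
    note dets = this[unfolded u_def v_def]
    show ?thesis
      using less.prems(5) wh t'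
    proof (cases rule: tetrahedron_exchange)
      case 1
      show ?thesis by (rule step[OF 1(1) t(2) wX abc(2,3) dets(1) 1(2)])
    next
      case 2
      show ?thesis by (rule step[OF 2(1) rs(2) abc(1) wX abc(3) dets(2) 2(2)])
    next
      case 3
      show ?thesis by (rule step[OF 3(1) rs(4) abc(1,2) wX dets(3) 3(2)])
    qed simp
  qed
qed

text \<open>Tetrahedra with two horizontal edges, by induction on the volume. The hypothesis \<open>strip\<close> supplies the
  point \<open>w\<close> for the exchange. Putting \<open>w\<close> in the place of an end point of the edge at the height of
  \<open>w\<close> gives a smaller tetrahedron of the same kind; putting it in the place of an end point of the
  other edge gives a tetrahedron with a horizontal facet, whose volume need not be smaller.\<close>

lemma covered_opposite_edges:
  assumes C: "convex C" and PQ: "convex P" "at_height 0 ` P \<subseteq> C" "convex Q" "at_height 1 ` Q \<subseteq> C"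
    and strip: "\<And>p u q v. \<lbrakk>p \<in> P \<inter> int_lattice; p + u \<in> P \<inter> int_lattice; q \<in> Q \<inter> int_lattice;
        q + v \<in> Q \<inter> int_lattice; 1 < \<bar>det2 u v\<bar>\<rbrakk> \<Longrightarrow>
      (\<exists>w\<in>P \<inter> int_lattice. 0 < det2 (w - p) v / det2 u v \<and> det2 (w - p) v / det2 u v < 1) \<or>
      (\<exists>w\<in>Q \<inter> int_lattice. 0 < det2 u (w - q) / det2 u v \<and> det2 u (w - q) / det2 u v < 1)"
    and p: "p \<in> P \<inter> int_lattice" "p' \<in> P \<inter> int_lattice"
    and q: "q \<in> Q \<inter> int_lattice" "q' \<in> Q \<inter> int_lattice"
    and nz: "det2 (p' - p) (q' - q) \<noteq> 0"
    and x: "x \<in> convex hull {at_height 0 p, at_height 0 p', at_height 1 q, at_height 1 q'}"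
  shows "covered C x"
  using p q nz x
proof (induction "nat \<lfloor>\<bar>det2 (p' - p) (q' - q)\<bar>\<rfloor>" arbitrary: p p' q q' rule: less_induct)
  case (less p p' q q')
  note p = less.prems(1,2) and q = less.prems(3,4)
  define u v where "u = p' - p" and "v = q' - q"
  have uv: "det2 u v \<noteq> 0" using less.prems(5) by (simp add: u_def v_def)
  have int: "det2 (p' - p) (q' - q) \<in> \<int>" using p q by (intro det2_Ints int_lattice_diff) auto
  have inC: "at_height 0 y \<in> C" if "y \<in> P" for y using PQ that by blast
  have inC': "at_height 1 y \<in> C" if "y \<in> Q" for y using PQ that by blast
  have step: "covered C x" if "0 < k" "k < 1" "r \<in> P \<inter> int_lattice" "r' \<in> P \<inter> int_lattice"
    "s \<in> Q \<inter> int_lattice" "s' \<in> Q \<inter> int_lattice"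
    "det2 (r' - r) (s' - s) = k * det2 (p' - p) (q' - q)"
    "x \<in> convex hull {at_height 0 r, at_height 0 r', at_height 1 s, at_height 1 s'}" for k r r' s s'
  proof (rule less.hyps[OF _ that(3-6)])
    show "det2 (r' - r) (s' - s) \<noteq> 0" using that(1,7) less.prems(5) by simp
    have "\<bar>det2 (r' - r) (s' - s)\<bar> < \<bar>det2 (p' - p) (q' - q)\<bar>"
      using mult_strict_right_mono[OF that(2), of "\<bar>det2 (p' - p) (q' - q)\<bar>"] that(1,7) less.prems(5)
      by (auto simp: abs_mult)
    moreover have "det2 (r' - r) (s' - s) \<in> \<int>" using that by (intro det2_Ints int_lattice_diff) auto
    ultimately show "nat \<lfloor>\<bar>det2 (r' - r) (s' - s)\<bar>\<rfloor> < nat \<lfloor>\<bar>det2 (p' - p) (q' - q)\<bar>\<rfloor>"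
      using int Ints_nat_floor_less by blast
  qed (use that in auto)
  show ?case
    using int less.prems(5)
  proof (cases rule: Ints_abs_cases)
    case 1
    have "unimodular_tetrahedron (convex hull {at_height 0 p, at_height 0 p', at_height 1 q, at_height 1 q'})"
    proof (rule unimodular_tetrahedron_hull)
      show "\<bar>det (vector [at_height 0 p' - at_height 0 p, at_height 1 q - at_height 0 p,
          at_height 1 q' - at_height 0 p] :: real ^ 3 ^ 3)\<bar> = 1"
        unfolding det_opposite_edges using 1 by simp
    qed (use p q in \<open>auto intro: at_height_in_lattice\<close>)
    moreover have "convex hull {at_height 0 p, at_height 0 p', at_height 1 q, at_height 1 q'} \<subseteq> C"
      using p q inC inC' C by (intro hull_minimal) auto
    ultimately show ?thesis unfolding covered_def using less.prems(6) by blast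
  next
    case 2
    have pu: "p + u = p'" and qv: "q + v = q'" by (simp_all add: u_def v_def)
    consider w where "w \<in> P \<inter> int_lattice" "0 < det2 (w - p) v / det2 u v" "det2 (w - p) v / det2 u v < 1"
      | w where "w \<in> Q \<inter> int_lattice" "0 < det2 u (w - q) / det2 u v" "det2 u (w - q) / det2 u v < 1"
      using strip[of p u q v] p q 2 pu qv unfolding u_def v_def by auto
    then show ?thesis
    proof cases
      case (1 w)
      define \<alpha> \<beta> where "\<alpha> = det2 (w - p) v / det2 u v" and "\<beta> = det2 u (w - p) / det2 u v"
      have w: "w = p + \<alpha> *\<^sub>R u + \<beta> *\<^sub>R v"
        using det2_expand[OF uv, of "w - p"] by (simp add: \<alpha>_def \<beta>_def algebra_simps)
      have a: "0 < \<alpha>" "\<alpha> < 1" using 1 by (auto simp: \<alpha>_def)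
      have wh: "at_height 0 w = (1 - \<alpha>) *\<^sub>R at_height 0 p + \<alpha> *\<^sub>R at_height 0 p'
          + (- \<beta>) *\<^sub>R at_height 1 q + \<beta> *\<^sub>R at_height 1 q'"
        by (simp add: w u_def v_def at_height_def vec_eq_iff forall_3 algebra_simps)
      have "p' - w = (1 - \<alpha>) *\<^sub>R u - \<beta> *\<^sub>R v" "w - p = \<alpha> *\<^sub>R u + \<beta> *\<^sub>R v"
        by (simp_all add: w u_def algebra_simps)
      then have "det2 (p' - w) v = (1 - \<alpha>) * det2 u v" "det2 (w - p) v = \<alpha> * det2 u v"
        by (simp_all add: det2_linear)
      note dets = this[unfolded u_def v_def]
      have coeffs: "(1 - \<alpha>) + \<alpha> + (- \<beta>) + \<beta> = 1" by simp
      have tri: "det2 (p' - p) (w - p) = \<beta> * det2 u v"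
        using uv by (simp add: \<beta>_def u_def)
      show ?thesis
        using less.prems(6) wh coeffs
      proof (cases rule: tetrahedron_exchange)
        case A: 1
        show ?thesis
          by (rule step[OF _ _ 1(1) p(2) q, of "1 - \<alpha>"])
            (use A a dets in auto)
      next
        case A: 2
        show ?thesis
          by (rule step[OF _ _ p(1) 1(1) q, of "\<alpha>"])
            (use A a dets in auto)
      next
        case A: 3
        show ?thesis
          by (rule covered_apex_triangle[OF C PQ(1,2), of 1 q' p p' w])
            (use A tri uv p q 1(1) inC' in \<open>auto simp: insert_commute\<close>)
      next
        case A: 4
        show ?thesis
          by (rule covered_apex_triangle[OF C PQ(1,2), of 1 q p p' w])
            (use A tri uv p q 1(1) inC' in \<open>auto simp: insert_commute\<close>)
      qed
    next
      case (2 w)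
      define \<alpha> \<beta> where "\<alpha> = det2 (w - q) v / det2 u v" and "\<beta> = det2 u (w - q) / det2 u v"
      have w: "w = q + \<alpha> *\<^sub>R u + \<beta> *\<^sub>R v"
        using det2_expand[OF uv, of "w - q"] by (simp add: \<alpha>_def \<beta>_def algebra_simps)
      have b: "0 < \<beta>" "\<beta> < 1" using 2 by (auto simp: \<beta>_def)
      have wh: "at_height 1 w = (- \<alpha>) *\<^sub>R at_height 0 p + \<alpha> *\<^sub>R at_height 0 p'
          + (1 - \<beta>) *\<^sub>R at_height 1 q + \<beta> *\<^sub>R at_height 1 q'"
        by (simp add: w u_def v_def at_height_def vec_eq_iff forall_3 algebra_simps)
      have "q' - w = (1 - \<beta>) *\<^sub>R v - \<alpha> *\<^sub>R u" "w - q = \<alpha> *\<^sub>R u + \<beta> *\<^sub>R v"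
        by (simp_all add: w v_def algebra_simps)
      then have "det2 u (q' - w) = (1 - \<beta>) * det2 u v" "det2 u (w - q) = \<beta> * det2 u v"
        by (simp_all add: det2_linear)
      note dets = this[unfolded u_def v_def]
      have coeffs: "(- \<alpha>) + \<alpha> + (1 - \<beta>) + \<beta> = 1" by simp
      have tri: "det2 (q' - q) (w - q) = - (\<alpha> * det2 u v)"
        using uv det2_commute[of "w - q" v] by (simp add: \<alpha>_def v_def)
      show ?thesis
        using less.prems(6) wh coeffs
      proof (cases rule: tetrahedron_exchange)
        case A: 1
        show ?thesis
          by (rule covered_apex_triangle[OF C PQ(3,4), of 0 p' q q' w])
            (use A tri uv p q 2(1) inC in \<open>auto simp: insert_commute\<close>)
      next
        case A: 2
        show ?thesis
          by (rule covered_apex_triangle[OF C PQ(3,4), of 0 p q q' w])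
            (use A tri uv p q 2(1) inC in \<open>auto simp: insert_commute\<close>)
      next
        case A: 3
        show ?thesis
          by (rule step[OF _ _ p 2(1) q(2), of "1 - \<beta>"])
            (use A b dets in auto)
      next
        case A: 4
        show ?thesis
          by (rule step[OF _ _ p q(1) 2(1), of "\<beta>"])
            (use A b dets in auto)
      qed
    qed
  qed
qed

section \<open>Cayley sums\<close>

text \<open>Caratheodory's theorem with an affinely independent set of full dimension: a smallest subset whose
  hull contains \<open>x\<close> is affinely independent, and it is extended to an affine basis.\<close>

lemma affinely_independent_simplex_containing:
  fixes V :: "'a::euclidean_space set"
  assumes "finite V" "x \<in> convex hull V"
  obtains T where "T \<subseteq> V" "\<not> affine_dependent T" "int (card T) = aff_dim V + 1" "x \<in> convex hull T"
proof -
  obtain S where S: "S \<subseteq> V" "x \<in> convex hull S"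
    and least: "\<And>S'. S' \<subseteq> V \<and> x \<in> convex hull S' \<Longrightarrow> card S \<le> card S'"
    using ex_has_least_nat[of "\<lambda>S. S \<subseteq> V \<and> x \<in> convex hull S" V card] assms(2) by blast
  have fin: "finite S" using S(1) assms(1) finite_subset by blast
  have "\<not> affine_dependent S"
  proof
    assume "affine_dependent S"
    then have "aff_dim S \<noteq> int (card S) - 1" using affine_independent_iff_card[of S] fin by blast
    then have small: "aff_dim S + 1 < int (card S)" using aff_dim_le_card[OF fin] by linarith
    obtain S' where "S' \<subseteq> S" "int (card S') \<le> aff_dim S + 1" "x \<in> convex hull S'"
      using S(2) unfolding caratheodory_aff_dim[of S] by blast
    then show False using least[of S'] S(1) small by force
  qed
  then obtain T where T: "\<not> affine_dependent T" "S \<subseteq> T" "T \<subseteq> V" "affine hull T = affine hull V"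
    using extend_to_affine_basis[OF _ S(1)] by blast
  show thesis
  proof (rule that[OF T(3,1)])
    show "int (card T) = aff_dim V + 1" using aff_dim_unique[of T V] T by simp
    show "x \<in> convex hull T" using S(2) hull_mono[OF T(2)] by blast
  qed
qed

lemma at_height_eq: "at_height h = (\<lambda>x. at_height h 0 + at_height 0 x)"
  by (simp add: fun_eq_iff at_height_def vec_eq_iff forall_3)

lemma linear_at_height_0: "linear (at_height 0)"
  by (rule linearI) (simp_all add: at_height_def vec_eq_iff forall_3)

lemma at_height_inject [simp]: "at_height h x = at_height h y \<longleftrightarrow> x = y"
  by (simp add: at_height_def vec_eq_iff forall_3 forall_2)

lemma at_height_convex_hull: "at_height h ` (convex hull S) = convex hull (at_height h ` S)"
proof -
  have "at_height h ` X = (+) (at_height h 0) ` at_height 0 ` X" for X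
    by (subst at_height_eq) (simp add: image_image)
  then show ?thesis
    by (simp only: convex_hull_translation[symmetric] convex_hull_linear_image[OF linear_at_height_0])
qed

lemma Cayley_sum_convex_hull:
  "Cayley_sum (convex hull S) (convex hull R) = convex hull (at_height 0 ` S \<union> at_height 1 ` R)"
  unfolding Cayley_sum_def at_height_convex_hull by (metis hull_Un_left hull_Un_right)

lemma aff_dim_at_height: "aff_dim (at_height h ` S) = aff_dim S"
proof -
  have "at_height h ` S = (+) (at_height h 0) ` at_height 0 ` S"
    by (subst at_height_eq) (simp add: image_image)
  moreover have "inj (at_height 0)" by (simp add: inj_def)
  ultimately show ?thesis using linear_at_height_0 by (simp add: aff_dim_translation_eq)
qed

lemma aff_dim_horizontal: "aff_dim {z :: real ^ 3. z $ 3 = h} = 2"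
proof -
  have "{z :: real ^ 3. z $ 3 = h} = {z. axis 3 1 \<bullet> z = h}" by (simp add: inner_axis')
  moreover have "axis 3 1 \<noteq> (0 :: real ^ 3)" by (simp add: axis_eq_0_iff)
  ultimately show ?thesis using aff_dim_hyperplane[of "axis 3 1 :: real ^ 3" h] by simp
qed

lemma aff_dim_Cayley_vertices:
  assumes "S \<noteq> {}" "aff_dim R = 2"
  shows "aff_dim (at_height 0 ` S \<union> at_height 1 ` R) = 3"
proof -
  obtain s where s: "s \<in> S" using assms(1) by blast
  have "affine {z :: real ^ 3. z $ 3 = 1}"
    unfolding affine_def by (simp add: distrib_right[symmetric])
  then have "affine hull (at_height 1 ` R) \<subseteq> {z. z $ 3 = 1}"
    by (intro hull_minimal) (auto simp: at_height_def)
  then have "at_height 0 s \<notin> affine hull (at_height 1 ` R)" by (auto simp: at_height_def)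
  then have "aff_dim (insert (at_height 0 s) (at_height 1 ` R)) = 3"
    using assms(2) by (simp add: aff_dim_insert aff_dim_at_height)
  moreover have "aff_dim (insert (at_height 0 s) (at_height 1 ` R)) \<le> aff_dim (at_height 0 ` S \<union> at_height 1 ` R)"
    using s by (intro aff_dim_subset) auto
  moreover have "aff_dim (at_height 0 ` S \<union> at_height 1 ` R) \<le> 3"
    using aff_dim_le_DIM[of "at_height 0 ` S \<union> at_height 1 ` R"] by simp
  ultimately show ?thesis by simp
qed

lemma det2_zero_dependency:
  assumes "det2 u v = 0"
  shows "(u \<bullet> u) *\<^sub>R v = (u \<bullet> v) *\<^sub>R u"
proof -
  have "(u \<bullet> u) *\<^sub>R v - (u \<bullet> v) *\<^sub>R u = det2 u v *\<^sub>R vector [- u $ 2, u $ 1]"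
    by (simp add: vec_eq_iff forall_2 inner_vec_def sum_2 det2_def algebra_simps)
  then show ?thesis using assms by simp
qed

lemma det2_nonzero_triangle:
  assumes ind: "\<not> affine_dependent {at_height h a, at_height h b, at_height h c}"
    and ne: "a \<noteq> b" "a \<noteq> c" "b \<noteq> c"
  shows "det2 (b - a) (c - a) \<noteq> 0"
proof
  assume "det2 (b - a) (c - a) = 0"
  define s t where "s = (b - a) \<bullet> (c - a)" and "t = (b - a) \<bullet> (b - a)"
  have st: "t *\<^sub>R (c - a) = s *\<^sub>R (b - a)"
    unfolding s_def t_def by (rule det2_zero_dependency) fact
  have comp: "t * (c $ i - a $ i) = s * (b $ i - a $ i)" for i
    using st by (simp add: vec_eq_iff)
  define k where "k z = (if z = at_height h c then t else if z = at_height h b then - s else s - t)" for z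
  have "sum k {at_height h a, at_height h b, at_height h c} = 0"
    using ne by (simp add: k_def)
  moreover have "k (at_height h c) \<noteq> 0" using ne by (simp add: k_def t_def)
  moreover have "(\<Sum>z\<in>{at_height h a, at_height h b, at_height h c}. k z *\<^sub>R z)
      = t *\<^sub>R at_height h c - s *\<^sub>R at_height h b + (s - t) *\<^sub>R at_height h a"
    using ne by (simp add: k_def)
  moreover have "t *\<^sub>R at_height h c - s *\<^sub>R at_height h b + (s - t) *\<^sub>R at_height h a = 0"
    using comp[of 1] comp[of 2] by (simp add: vec_eq_iff forall_3 at_height_def algebra_simps)
  ultimately have "affine_dependent {at_height h a, at_height h b, at_height h c}"
    by (subst affine_dependent_explicit_finite)
      (auto intro!: exI[of _ k] bexI[of _ "at_height h c"] simp del: sum.insert)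
  then show False using ind by simp
qed

lemma det2_nonzero_opposite_edges:
  assumes ind: "\<not> affine_dependent {at_height 0 p, at_height 0 p', at_height 1 q, at_height 1 q'}"
    and ne: "p \<noteq> p'" "q \<noteq> q'"
  shows "det2 (p' - p) (q' - q) \<noteq> 0"
proof
  assume "det2 (p' - p) (q' - q) = 0"
  define s t where "s = (p' - p) \<bullet> (q' - q)" and "t = (p' - p) \<bullet> (p' - p)"
  have st: "t *\<^sub>R (q' - q) = s *\<^sub>R (p' - p)"
    unfolding s_def t_def by (rule det2_zero_dependency) fact
  have comp: "t * (q' $ i - q $ i) = s * (p' $ i - p $ i)" for i
    using st by (simp add: vec_eq_iff)
  have levels: "at_height 0 x \<noteq> at_height 1 y" "at_height 1 y \<noteq> at_height 0 x" for x y
    by (simp_all add: at_height_def vec_eq_iff forall_3)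
  define k where "k z = (if z = at_height 1 q' then t else if z = at_height 1 q then - t
      else if z = at_height 0 p' then - s else s)" for z
  have "sum k {at_height 0 p, at_height 0 p', at_height 1 q, at_height 1 q'} = 0"
    using ne levels by (simp add: k_def)
  moreover have "k (at_height 1 q') \<noteq> 0" using ne by (simp add: k_def t_def)
  moreover have "(\<Sum>z\<in>{at_height 0 p, at_height 0 p', at_height 1 q, at_height 1 q'}. k z *\<^sub>R z)
      = t *\<^sub>R at_height 1 q' - t *\<^sub>R at_height 1 q - s *\<^sub>R at_height 0 p' + s *\<^sub>R at_height 0 p"
    using ne levels by (simp add: k_def)
  moreover have "t *\<^sub>R at_height 1 q' - t *\<^sub>R at_height 1 q - s *\<^sub>R at_height 0 p' + s *\<^sub>R at_height 0 p = 0"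
    using comp[of 1] comp[of 2] by (simp add: vec_eq_iff forall_3 at_height_def algebra_simps)
  ultimately have "affine_dependent {at_height 0 p, at_height 0 p', at_height 1 q, at_height 1 q'}"
    by (subst affine_dependent_explicit_finite)
      (auto intro!: exI[of _ k] bexI[of _ "at_height 1 q'"] simp del: sum.insert)
  then show False using ind by simp
qed

lemma Cayley_sum_covered:
  assumes S: "finite S" "S \<subseteq> int_lattice" "S \<noteq> {}" and R: "finite R" "R \<subseteq> int_lattice" "aff_dim R = 2"
    and wms: "weak_Minkowski_summand (convex hull S) (convex hull R)"
    and x: "x \<in> Cayley_sum (convex hull S) (convex hull R)"
  shows "covered (Cayley_sum (convex hull S) (convex hull R)) x"
proof -
  define P Q C where "P = convex hull S" and "Q = convex hull R" and "C = Cayley_sum P Q"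
  have C: "convex C" by (simp add: C_def Cayley_sum_def)
  have P: "convex P" "at_height 0 ` P \<subseteq> C" and Q: "convex Q" "at_height 1 ` Q \<subseteq> C"
    by (auto simp: P_def Q_def C_def Cayley_sum_def intro: hull_inc)
  have SP: "S \<subseteq> P \<inter> int_lattice" and RQ: "R \<subseteq> Q \<inter> int_lattice"
    using S R hull_subset[of S convex] hull_subset[of R convex] by (auto simp: P_def Q_def)
  have "R \<noteq> {}" using R(3) by auto
  note edges = parallel_edge_of_refining_fan[OF R(1) Q_def this wms[folded P_def Q_def]]
  have strip: "(\<exists>w\<in>P \<inter> int_lattice. 0 < det2 (w - p) v / det2 u v \<and> det2 (w - p) v / det2 u v < 1) \<or>
      (\<exists>w\<in>Q \<inter> int_lattice. 0 < det2 u (w - q) / det2 u v \<and> det2 u (w - q) / det2 u v < 1)"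
    if "p \<in> P \<inter> int_lattice" "p + u \<in> P \<inter> int_lattice" "q \<in> Q \<inter> int_lattice"
      "q + v \<in> Q \<inter> int_lattice" "1 < \<bar>det2 u v\<bar>" for p u q v
    by (rule lattice_point_in_strip[OF S(1,2) P_def R(1,2) Q_def edges that])
  define V where "V = at_height 0 ` S \<union> at_height 1 ` R"
  have "x \<in> convex hull V" using x unfolding Cayley_sum_convex_hull V_def .
  moreover have "finite V" using S R by (simp add: V_def)
  ultimately obtain T where T: "T \<subseteq> V" "\<not> affine_dependent T" "int (card T) = aff_dim V + 1" "x \<in> convex hull T"
    using affinely_independent_simplex_containing by blast
  have cT: "card T = 4" using T(3) aff_dim_Cayley_vertices[OF S(3) R(3)] by (simp add: V_def)
  then have finT: "finite T" using card.infinite by fastforce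
  \<comment> \<open>A horizontal plane contains at most 3 of the vertices, as they are affinely independent.\<close>
  define A where "A h = T \<inter> {z. z $ 3 = h}" for h
  have A0: "A 0 \<subseteq> at_height 0 ` S" and A1: "A 1 \<subseteq> at_height 1 ` R"
    using T(1) by (auto simp: A_def V_def at_height_def)
  have TA: "T = A 0 \<union> A 1" using T(1) by (auto simp: A_def V_def at_height_def)
  have "A 0 \<inter> A 1 = {}" by (auto simp: A_def)
  then have sum4: "card (A 0) + card (A 1) = 4"
    using card_Un_disjoint[of "A 0" "A 1"] finT cT TA by (metis finite_Un)
  have le3: "card (A h) \<le> 3" for h
  proof -
    have "\<not> affine_dependent (A h)" using T(2) affine_independent_subset[of T "A h"] by (auto simp: A_def)
    then have "int (card (A h)) = aff_dim (A h) + 1" by (rule aff_dim_affine_independent)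
    also have "\<dots> \<le> 3" using aff_dim_subset[of "A h" "{z. z $ 3 = h}"] aff_dim_horizontal[of h] by (auto simp: A_def)
    finally show ?thesis by simp
  qed
  have sub: "\<not> affine_dependent X" if "X \<subseteq> T" for X using T(2) affine_independent_subset that by blast
  consider "card (A 0) = 3" "card (A 1) = 1" | "card (A 0) = 2" "card (A 1) = 2" | "card (A 0) = 1" "card (A 1) = 3"
    using sum4 le3[of 0] le3[of 1] by linarith
  then have "covered C x"
  proof cases
    case 1
    obtain a' b' c' where abc': "A 0 = {a', b', c'}" "a' \<noteq> b'" "a' \<noteq> c'" "b' \<noteq> c'"
      using 1(1) by (auto simp: card_3_iff)
    obtain d' where d': "A 1 = {d'}" using 1(2) card_1_singletonE by blast
    have "a' \<in> at_height 0 ` S" "b' \<in> at_height 0 ` S" "c' \<in> at_height 0 ` S" using A0 abc'(1) by auto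
    then obtain a b c where abc: "a \<in> S" "b \<in> S" "c \<in> S"
      "a' = at_height 0 a" "b' = at_height 0 b" "c' = at_height 0 c"
      by (elim imageE) blast
    obtain d where d: "d \<in> R" "d' = at_height 1 d" using A1 unfolding d' by auto
    have "\<not> affine_dependent {at_height 0 a, at_height 0 b, at_height 0 c}"
      using sub[of "A 0"] abc'(1) abc(4-6) TA by simp
    then have "det2 (b - a) (c - a) \<noteq> 0" by (rule det2_nonzero_triangle) (use abc' abc in auto)
    moreover have "at_height 1 d \<in> C" using d(1) RQ Q(2) by blast
    moreover have "x \<in> convex hull {at_height 0 a, at_height 0 b, at_height 0 c, at_height 1 d}"
      using T(4) TA abc' d' abc d by (simp add: insert_commute)
    ultimately show ?thesis
      by (intro covered_apex_triangle[OF C P, of 1 d a b c]) (use SP RQ abc d in auto)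
  next
    case 2
    obtain p1 p2 where p': "A 0 = {p1, p2}" "p1 \<noteq> p2" using 2(1) by (auto simp: card_2_iff)
    obtain q1 q2 where q': "A 1 = {q1, q2}" "q1 \<noteq> q2" using 2(2) by (auto simp: card_2_iff)
    have "p1 \<in> at_height 0 ` S" "p2 \<in> at_height 0 ` S" using A0 p'(1) by auto
    then obtain p r where p: "p \<in> S" "r \<in> S" "p1 = at_height 0 p" "p2 = at_height 0 r"
      by (elim imageE) blast
    have "q1 \<in> at_height 1 ` R" "q2 \<in> at_height 1 ` R" using A1 q'(1) by auto
    then obtain q s where q: "q \<in> R" "s \<in> R" "q1 = at_height 1 q" "q2 = at_height 1 s"
      by (elim imageE) blast
    have T4: "T = {at_height 0 p, at_height 0 r, at_height 1 q, at_height 1 s}"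
      using TA p' q' p q by auto
    have "det2 (r - p) (s - q) \<noteq> 0"
      by (rule det2_nonzero_opposite_edges) (use T(2) T4 p' q' p q in auto)
    then show ?thesis
      by (intro covered_opposite_edges[OF C P Q strip, of p r q s]) (use SP RQ T(4) T4 p q in auto)
  next
    case 3
    obtain a' b' c' where abc': "A 1 = {a', b', c'}" "a' \<noteq> b'" "a' \<noteq> c'" "b' \<noteq> c'"
      using 3(2) by (auto simp: card_3_iff)
    obtain d' where d': "A 0 = {d'}" using 3(1) card_1_singletonE by blast
    have "a' \<in> at_height 1 ` R" "b' \<in> at_height 1 ` R" "c' \<in> at_height 1 ` R" using A1 abc'(1) by auto
    then obtain a b c where abc: "a \<in> R" "b \<in> R" "c \<in> R"
      "a' = at_height 1 a" "b' = at_height 1 b" "c' = at_height 1 c"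
      by (elim imageE) blast
    obtain d where d: "d \<in> S" "d' = at_height 0 d" using A0 unfolding d' by auto
    have "\<not> affine_dependent {at_height 1 a, at_height 1 b, at_height 1 c}"
      using sub[of "A 1"] abc'(1) abc(4-6) TA by simp
    then have "det2 (b - a) (c - a) \<noteq> 0" by (rule det2_nonzero_triangle) (use abc' abc in auto)
    moreover have "at_height 0 d \<in> C" using d(1) SP P(2) by blast
    moreover have "x \<in> convex hull {at_height 1 a, at_height 1 b, at_height 1 c, at_height 0 d}"
      using T(4) TA abc' d' abc d by (simp add: insert_commute)
    ultimately show ?thesis
      by (intro covered_apex_triangle[OF C Q, of 0 d a b c]) (use SP RQ abc d in auto)
  qed
  then show ?thesis by (simp add: C_def P_def Q_def)
qed

lemma weak_Minkowski_summand_nonempty: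
  assumes "weak_Minkowski_summand P Q" "convex Q" "Q \<noteq> {}"
  shows "P \<noteq> {}"
proof
  assume "P = {}"
  then have "normal_fan P = {}" by (auto simp: normal_fan_def)
  moreover have "normal_cone Q Q \<in> normal_fan Q"
    using assms face_of_refl by (auto simp: normal_fan_def)
  moreover have "0 \<in> normal_cone Q Q" by (simp add: normal_cone_def)
  ultimately show False
    using assms(1) by (auto simp: weak_Minkowski_summand_def fan_refines_def)
qed

theorem theorem1p6:
  fixes P Q :: "(real ^ 2) set"
  assumes "lattice_polygon Q"
    and "lattice_polytope P"
    and "weak_Minkowski_summand P Q"
  shows "\<exists>\<T>. unimodular_cover \<T> (Cayley_sum P Q)"
proof -
  obtain R where R: "finite R" "R \<subseteq> int_lattice" "Q = convex hull R" and "aff_dim Q = 2"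
    using assms(1) unfolding lattice_polygon_def lattice_polytope_def by blast
  then have dim: "aff_dim R = 2" by (simp add: aff_dim_convex_hull)
  obtain S where S: "finite S" "S \<subseteq> int_lattice" "P = convex hull S"
    using assms(2) unfolding lattice_polytope_def by blast
  have "Q \<noteq> {}" using \<open>aff_dim Q = 2\<close> by auto
  then have "P \<noteq> {}" using weak_Minkowski_summand_nonempty[OF assms(3)] R(3) by simp
  then have "S \<noteq> {}" using S(3) by auto
  then have "covered (Cayley_sum P Q) x" if "x \<in> Cayley_sum P Q" for x
    using Cayley_sum_covered[OF S(1,2) _ R(1,2) dim] assms(3) that unfolding S(3) R(3) by blast
  then have "unimodular_cover {T. unimodular_tetrahedron T \<and> T \<subseteq> Cayley_sum P Q} (Cayley_sum P Q)"
    unfolding unimodular_cover_def covered_def by blast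
  then show ?thesis by blast
qed

end
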